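(* The enveloping group $\mathrm{Gr}(P)$ of Thompson's quandle $P$ is isomorphic to Thompson's group $F$.
   Context: A quandle is a set $Q$ with a binary operation $\rhd$ such that for every $x\in Q$ the left multiplication $y\mapsto x\rhd y$ is bijective, $x\rhd(y\rhd z)=(x\rhd y)\rhd(x\rhd z)$ for all $x,y,z$, and $x\rhd x=x$ for all $x$. Thompson's quandle $P$ is the quandle with generators $p_0,p_1,p_2,\dots$ and relations $p_j\rhd p_k=p_{k+1}$ for all $0\leqslant j<k$. The enveloping group $\mathrm{Gr}(Q)$ of a quandle $Q$ is the group with generating set $\{g_x\mid x\in Q\}$ and relations $g_{x\rhd y}=g_xg_y(g_x)^{-1}$ for all $x,y\in Q$. Thompson's group $F$ is the group of piecewise linear orientation-preserving homeomorphisms of $[0,1]$ with finitely many breakpoints, all at dyadic rationals, and all slopes integer powers of $2$; by standard facts, it has the presentation $\langle x_0,x_1,x_2,\dots\mid x_jx_kx_j^{-1}=x_{k+1}\text{ for all }j<k\rangle$. *)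

theory Defs
  imports "HOL-Analysis.Analysis" "HOL-Algebra.Bij"
begin

section \<open>Quandles\<close>

record 'a quandle = "'a partial_object" +
  qop :: "['a, 'a] \<Rightarrow> 'a" (infixr \<open>\<rhd>\<index>\<close> 70)

locale quandle =
  fixes Q (structure)
  assumes bij_left: "x \<in> carrier Q \<Longrightarrow> bij_betw (\<lambda>y. x \<rhd> y) (carrier Q) (carrier Q)"
    and self_distrib: "\<lbrakk>x \<in> carrier Q; y \<in> carrier Q; z \<in> carrier Q\<rbrakk>
      \<Longrightarrow> x \<rhd> (y \<rhd> z) = (x \<rhd> y) \<rhd> (x \<rhd> z)"
    and idem: "x \<in> carrier Q \<Longrightarrow> x \<rhd> x = x"


section \<open>Quandles given by generators and relations\<close>

text \<open>
  Quandles form a variety once the inverse of left multiplication by \<open>x\<close> is regarded as a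
  second operation: \<open>QInv x y\<close> stands for the unique \<open>z\<close> with \<open>x \<rhd> z = y\<close>. The quandle with
  generators the elements of \<open>'a\<close> and relations \<open>R\<close> is the algebra of terms in both operations,
  modulo the least congruence that contains \<open>R\<close> and makes the quotient a quandle.
\<close>

datatype 'a qterm = QGen 'a | QOp "'a qterm" "'a qterm" | QInv "'a qterm" "'a qterm"

inductive qcong :: "('a qterm \<times> 'a qterm) set \<Rightarrow> 'a qterm \<Rightarrow> 'a qterm \<Rightarrow> bool"
  for R where
  qcong_relation: "(s, t) \<in> R \<Longrightarrow> qcong R s t"
| qcong_refl: "qcong R t t"
| qcong_sym: "qcong R s t \<Longrightarrow> qcong R t s"
| qcong_trans: "qcong R s t \<Longrightarrow> qcong R t u \<Longrightarrow> qcong R s u"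
| qcong_QOp: "qcong R s s' \<Longrightarrow> qcong R t t' \<Longrightarrow> qcong R (QOp s t) (QOp s' t')"
| qcong_QInv: "qcong R s s' \<Longrightarrow> qcong R t t' \<Longrightarrow> qcong R (QInv s t) (QInv s' t')"
| qcong_op_inv: "qcong R (QOp s (QInv s t)) t"
| qcong_inv_op: "qcong R (QInv s (QOp s t)) t"
| qcong_distrib: "qcong R (QOp s (QOp t u)) (QOp (QOp s t) (QOp s u))"
| qcong_idem: "qcong R (QOp t t) t"

definition qrel :: "('a qterm \<times> 'a qterm) set \<Rightarrow> ('a qterm \<times> 'a qterm) set" where
  "qrel R = {(s, t). qcong R s t}"

definition presented_quandle :: "('a qterm \<times> 'a qterm) set \<Rightarrow> 'a qterm set quandle" where
  "presented_quandle R =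
    \<lparr>carrier = UNIV // qrel R,
     qop = (\<lambda>A B. \<Union>s\<in>A. \<Union>t\<in>B. qrel R `` {QOp s t})\<rparr>"

lemma equiv_qrel: "equiv UNIV (qrel R)"
  by (intro equivI refl_onI symI transI)
    (auto simp: qrel_def intro: qcong_refl qcong_sym qcong_trans)

lemma presented_quandle_qop:
  "qrel R `` {s} \<rhd>\<^bsub>presented_quandle R\<^esub> qrel R `` {t} = qrel R `` {QOp s t}"
  unfolding presented_quandle_def qrel_def
  by (auto intro: qcong_QOp qcong_refl qcong_trans)

lemma qrel_class_eq: "qrel R `` {s} = qrel R `` {t} \<longleftrightarrow> qcong R s t"
  using eq_equiv_class_iff[OF equiv_qrel, of s t R] by (simp add: qrel_def)

lemma presented_quandle_cases:
  assumes "A \<in> carrier (presented_quandle R)"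
  obtains t where "A = qrel R `` {t}"
  using assms by (auto simp: presented_quandle_def elim: quotientE)

lemma presented_quandle_class: "qrel R `` {t} \<in> carrier (presented_quandle R)"
  by (auto simp: presented_quandle_def intro: quotientI)

theorem quandle_presented_quandle: "quandle (presented_quandle R)"
proof
  let ?Q = "presented_quandle R"
  fix A assume "A \<in> carrier ?Q"
  then obtain s where s: "A = qrel R `` {s}" by (rule presented_quandle_cases)
  show "bij_betw (\<lambda>B. A \<rhd>\<^bsub>?Q\<^esub> B) (carrier ?Q) (carrier ?Q)"
  proof (rule bij_betw_imageI)
    show "inj_on (\<lambda>B. A \<rhd>\<^bsub>?Q\<^esub> B) (carrier ?Q)"
    proof (rule inj_onI)
      fix B C assume "B \<in> carrier ?Q" "C \<in> carrier ?Q" and eq: "A \<rhd>\<^bsub>?Q\<^esub> B = A \<rhd>\<^bsub>?Q\<^esub> C"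
      then obtain t u where tu: "B = qrel R `` {t}" "C = qrel R `` {u}"
        by (metis presented_quandle_cases)
      from eq have "qcong R (QOp s t) (QOp s u)"
        by (simp add: s tu presented_quandle_qop qrel_class_eq)
      then have "qcong R (QInv s (QOp s t)) (QInv s (QOp s u))"
        by (rule qcong_QInv[OF qcong_refl])
      then have "qcong R t u"
        by (meson qcong_inv_op qcong_sym qcong_trans)
      then show "B = C" by (simp add: tu qrel_class_eq)
    qed
    show "(\<lambda>B. A \<rhd>\<^bsub>?Q\<^esub> B) ` carrier ?Q = carrier ?Q"
    proof (intro equalityI subsetI)
      fix B assume "B \<in> (\<lambda>B. A \<rhd>\<^bsub>?Q\<^esub> B) ` carrier ?Q"
      then obtain C where C: "C \<in> carrier ?Q" "B = A \<rhd>\<^bsub>?Q\<^esub> C" by blast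
      then obtain t where "C = qrel R `` {t}" by (metis presented_quandle_cases)
      then show "B \<in> carrier ?Q"
        by (simp add: C s presented_quandle_qop presented_quandle_class)
    next
      fix B assume "B \<in> carrier ?Q"
      then obtain t where t: "B = qrel R `` {t}" by (rule presented_quandle_cases)
      have "B = A \<rhd>\<^bsub>?Q\<^esub> qrel R `` {QInv s t}"
        by (simp add: s t presented_quandle_qop qrel_class_eq qcong_sym[OF qcong_op_inv])
      then show "B \<in> (\<lambda>B. A \<rhd>\<^bsub>?Q\<^esub> B) ` carrier ?Q"
        using presented_quandle_class by blast
    qed
  qed
next
  let ?Q = "presented_quandle R"
  fix A B C assume "A \<in> carrier ?Q" "B \<in> carrier ?Q" "C \<in> carrier ?Q"
  then obtain s t u where "A = qrel R `` {s}" "B = qrel R `` {t}" "C = qrel R `` {u}"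
    by (metis presented_quandle_cases)
  then show "A \<rhd>\<^bsub>?Q\<^esub> B \<rhd>\<^bsub>?Q\<^esub> C = (A \<rhd>\<^bsub>?Q\<^esub> B) \<rhd>\<^bsub>?Q\<^esub> A \<rhd>\<^bsub>?Q\<^esub> C"
    by (simp add: presented_quandle_qop qrel_class_eq qcong_distrib)
next
  let ?Q = "presented_quandle R"
  fix A assume "A \<in> carrier ?Q"
  then obtain t where "A = qrel R `` {t}" by (rule presented_quandle_cases)
  then show "A \<rhd>\<^bsub>?Q\<^esub> A = A"
    by (simp add: presented_quandle_qop qrel_class_eq qcong_idem)
qed


section \<open>Groups given by generators and relations\<close>

datatype 'a letter = Pos 'a | Neg 'a

fun flip :: "'a letter \<Rightarrow> 'a letter" where
  "flip (Pos x) = Neg x"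
| "flip (Neg x) = Pos x"

definition words :: "'a set \<Rightarrow> 'a letter list set" where
  "words X = {w. set w \<subseteq> Pos ` X \<union> Neg ` X}"

inductive gcong ::
  "'a set \<Rightarrow> ('a letter list \<times> 'a letter list) set \<Rightarrow> 'a letter list \<Rightarrow> 'a letter list \<Rightarrow> bool"
  for X R where
  gcong_relation: "(v, w) \<in> R \<Longrightarrow> v \<in> words X \<Longrightarrow> w \<in> words X \<Longrightarrow> gcong X R v w"
| gcong_cancel: "[a] \<in> words X \<Longrightarrow> gcong X R [a, flip a] []"
| gcong_refl: "w \<in> words X \<Longrightarrow> gcong X R w w"
| gcong_sym: "gcong X R v w \<Longrightarrow> gcong X R w v"
| gcong_trans: "gcong X R u v \<Longrightarrow> gcong X R v w \<Longrightarrow> gcong X R u w"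
| gcong_append: "gcong X R v v' \<Longrightarrow> gcong X R w w' \<Longrightarrow> gcong X R (v @ w) (v' @ w')"

definition grel ::
  "'a set \<Rightarrow> ('a letter list \<times> 'a letter list) set \<Rightarrow> ('a letter list \<times> 'a letter list) set" where
  "grel X R = {(v, w). gcong X R v w}"

definition presented_group ::
  "'a set \<Rightarrow> ('a letter list \<times> 'a letter list) set \<Rightarrow> 'a letter list set monoid" where
  "presented_group X R =
    \<lparr>carrier = words X // grel X R,
     mult = (\<lambda>A B. \<Union>v\<in>A. \<Union>w\<in>B. grel X R `` {v @ w}),
     one = grel X R `` {[]}\<rparr>"

lemma flip_flip: "flip (flip a) = a"
  by (cases a) auto

lemma words_simps:
  "[] \<in> words X"
  "a # w \<in> words X \<longleftrightarrow> [a] \<in> words X \<and> w \<in> words X"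
  "v @ w \<in> words X \<longleftrightarrow> v \<in> words X \<and> w \<in> words X"
  by (auto simp: words_def)

lemma flip_words: "[flip a] \<in> words X \<longleftrightarrow> [a] \<in> words X"
  by (cases a) (auto simp: words_def)

lemma gcong_words: "gcong X R v w \<Longrightarrow> v \<in> words X \<and> w \<in> words X"
proof (induction rule: gcong.induct)
  case (gcong_cancel a)
  then show ?case
    using words_simps(2)[of a "[flip a]" X] by (simp add: words_simps(1) flip_words)
qed (simp_all add: words_simps(1,3))

lemma equiv_grel: "equiv (words X) (grel X R)"
  by (intro equivI refl_onI symI transI)
    (auto simp: grel_def dest: gcong_words intro: gcong_refl gcong_sym gcong_trans)

lemma presented_group_mult:
  assumes "v \<in> words X" "w \<in> words X"
  shows "grel X R `` {v} \<otimes>\<^bsub>presented_group X R\<^esub> grel X R `` {w} = grel X R `` {v @ w}"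
  using assms unfolding presented_group_def grel_def
  by (auto intro: gcong_append gcong_refl gcong_trans)

lemma grel_class_eq:
  "v \<in> words X \<Longrightarrow> w \<in> words X \<Longrightarrow> grel X R `` {v} = grel X R `` {w} \<longleftrightarrow> gcong X R v w"
  using eq_equiv_class_iff[OF equiv_grel, of v X w R] by (simp add: grel_def)

lemma presented_group_cases:
  assumes "A \<in> carrier (presented_group X R)"
  obtains w where "w \<in> words X" "A = grel X R `` {w}"
  using assms by (auto simp: presented_group_def elim: quotientE)

lemma presented_group_class:
  "w \<in> words X \<Longrightarrow> grel X R `` {w} \<in> carrier (presented_group X R)"
  by (auto simp: presented_group_def intro: quotientI)

lemma gcong_inverse:
  "w \<in> words X \<Longrightarrow>
    map flip (rev w) \<in> words X \<and> gcong X R (map flip (rev w) @ w) []"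
proof (induction w)
  case Nil
  then show ?case by (simp add: gcong_refl words_simps(1))
next
  case (Cons a w)
  then have a: "[a] \<in> words X" and w: "w \<in> words X"
    using words_simps(2) by blast+
  let ?v = "map flip (rev w)"
  have v: "?v \<in> words X" "gcong X R (?v @ w) []" using Cons.IH w by auto
  have fa: "[flip a] \<in> words X" using a by (simp add: flip_words)
  have "gcong X R [flip a, a] []" using gcong_cancel[OF fa, of R] by (simp add: flip_flip)
  then have "gcong X R (?v @ [flip a, a] @ w) (?v @ [] @ w)"
    by (intro gcong_append gcong_refl v(1) w)
  then have "gcong X R (?v @ [flip a, a] @ w) []"
    using v(2) by (auto intro: gcong_trans)
  moreover have "?v @ [flip a] \<in> words X" using v(1) fa by (simp add: words_simps(3))
  ultimately show ?case by simp
qed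

theorem group_presented_group: "group (presented_group X R)"
proof (rule groupI)
  let ?G = "presented_group X R"
  have one: "\<one>\<^bsub>?G\<^esub> = grel X R `` {[]}" by (simp add: presented_group_def)
  show "\<one>\<^bsub>?G\<^esub> \<in> carrier ?G" by (simp add: one presented_group_class words_simps(1))
  fix A assume "A \<in> carrier ?G"
  then obtain u where u: "u \<in> words X" "A = grel X R `` {u}" by (rule presented_group_cases)
  show "\<one>\<^bsub>?G\<^esub> \<otimes>\<^bsub>?G\<^esub> A = A" by (simp add: one u presented_group_mult words_simps(1))
  have "grel X R `` {map flip (rev u)} \<otimes>\<^bsub>?G\<^esub> A = \<one>\<^bsub>?G\<^esub>"
    using gcong_inverse[OF u(1), of R]
    by (simp add: one u presented_group_mult grel_class_eq words_simps(1,3))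
  then show "\<exists>B\<in>carrier ?G. B \<otimes>\<^bsub>?G\<^esub> A = \<one>\<^bsub>?G\<^esub>"
    using gcong_inverse[OF u(1), of R] presented_group_class by blast
  fix B assume "B \<in> carrier ?G"
  then obtain v where v: "v \<in> words X" "B = grel X R `` {v}" by (rule presented_group_cases)
  show "A \<otimes>\<^bsub>?G\<^esub> B \<in> carrier ?G"
    by (simp add: u v presented_group_mult presented_group_class words_simps(3))
  fix C assume "C \<in> carrier ?G"
  then obtain w where w: "w \<in> words X" "C = grel X R `` {w}" by (rule presented_group_cases)
  show "A \<otimes>\<^bsub>?G\<^esub> B \<otimes>\<^bsub>?G\<^esub> C = A \<otimes>\<^bsub>?G\<^esub> (B \<otimes>\<^bsub>?G\<^esub> C)"
    by (simp add: u v w presented_group_mult words_simps(3))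
qed


section \<open>The enveloping group of a quandle\<close>

definition Gr :: "('a, 'b) quandle_scheme \<Rightarrow> 'a letter list set monoid" where
  "Gr Q = presented_group (carrier Q)
    {([Pos (x \<rhd>\<^bsub>Q\<^esub> y)], [Pos x, Pos y, Neg x]) | x y. x \<in> carrier Q \<and> y \<in> carrier Q}"


section \<open>Thompson's quandle and Thompson's group\<close>

definition thompson_quandle :: "nat qterm set quandle" where
  "thompson_quandle =
    presented_quandle {(QOp (QGen j) (QGen k), QGen (k + 1)) | j k. j < k}"

definition dyadic_rationals :: "real set" where
  "dyadic_rationals = {of_int a / 2 ^ n | (a :: int) (n :: nat). True}"

text \<open>
  The finite set \<open>B\<close> contains all breakpoints of \<open>f\<close>; it may contain further dyadic points.
  On every interval that avoids \<open>B\<close> the function is affine, with slope a power of two.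
\<close>

definition dyadic_piecewise_linear :: "(real \<Rightarrow> real) \<Rightarrow> bool" where
  "dyadic_piecewise_linear f \<longleftrightarrow>
    (\<exists>B. finite B \<and> B \<subseteq> dyadic_rationals \<and>
      (\<forall>a b. 0 \<le> a \<and> a < b \<and> b \<le> 1 \<and> {a<..<b} \<inter> B = {} \<longrightarrow>
        (\<exists>(m :: int) (c :: real). \<forall>x\<in>{a<..<b}. f x = 2 powi m * x + c)))"

text \<open>
  As in \<^const>\<open>BijGroup\<close>, the maps are represented by extensional functions on the unit
  interval, and the product is composition.
\<close>

definition thompson_group :: "(real \<Rightarrow> real) monoid" where
  "thompson_group = (BijGroup {0..1})
    \<lparr>carrier := {f \<in> Bij {0..1}.
      (\<exists>g. homeomorphism {0..1} {0..1} f g) \<and>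
      strict_mono_on {0..1} f \<and>
      dyadic_piecewise_linear f}\<rparr>"

end

theory Submission
  imports Defs "HOL-Algebra.Coset"
begin

text \<open>
  The enveloping group of a quandle given by generators and relations is the group with the same
  generators, where a relation \<open>a \<rhd> b = c\<close> becomes \<open>a b a\<^sup>-\<^sup>1 = c\<close>
  (\<open>Gr_presented_quandle_hom\<close>, \<open>Gr_presented_quandle_op\<close>, \<open>Gr_presented_quandle_generated\<close>).
  So \<open>Gr P\<close> has generators \<open>g\<^sub>k\<close> and relations \<open>g\<^sub>j g\<^sub>k = g\<^sub>k\<^sub>+\<^sub>1 g\<^sub>j\<close> for \<open>j < k\<close>, and the theorem
  says that the group of piecewise linear homeomorphisms has this presentation. The piecewise
  linear maps \<open>x\<^sub>k\<close> called \<open>thompson_gen k\<close> below satisfy the relations, because \<open>x\<^sub>j\<close> is affine on the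
  support \<open>[1 - 2\<^sup>-\<^sup>k, 1]\<close> of \<open>x\<^sub>k\<close> and carries it onto the support of \<open>x\<^sub>k\<^sub>+\<^sub>1\<close>. This gives a
  homomorphism from \<open>Gr P\<close> with \<open>g\<^sub>k \<mapsto> x\<^sub>k\<close>.

  It is injective. By the relations alone, each element of \<open>Gr P\<close> is a fraction \<open>u\<^sup>-\<^sup>1 v\<close> of positive
  words (\<open>subgroup_fractions\<close>), so it is enough that positive words with equal values are equal in
  \<open>Gr P\<close>. The value of a word determines its least letter \<open>i\<close>, as \<open>1 - 2\<^sup>-\<^sup>i\<close> is the
  point where the map starts to differ from the identity (\<open>pos_word_separated\<close>). The relations
  move this letter to the right end of both words, where it can be cancelled, and induction on the
  length applies (\<open>thompson_relations_hom.pos_eq\<close>).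

  It is surjective. Cut the interval at the points \<open>1 - 2\<^sup>-\<^sup>i\<close>, and consider the maps that carry
  finitely many of the resulting pieces, and the rest up to \<open>1\<close>, affinely onto consecutive standard
  dyadic intervals. Multiplication by \<open>x\<^sub>i\<^sup>-\<^sup>1\<close> on the right replaces the \<open>i\<close>-th of these image
  intervals by its two halves (\<open>forest_split\<close>), so within its coset of the subgroup generated by
  the \<open>x\<^sub>i\<close> such a map can be refined until all image intervals have length \<open>2\<^sup>-\<^sup>n\<close>, and then it
  is the only such map for this \<open>n\<close>, say \<open>u\<^sub>n\<close>. Starting from the identity shows that \<open>u\<^sub>n\<close> is
  in the subgroup. An arbitrary \<open>f\<close> in Thompson's group carries all standard dyadic intervals of
  some length \<open>2\<^sup>-\<^sup>n\<close> affinely onto standard dyadic intervals (\<open>thompson_group_dyadic_pieces\<close>), so \<open>f u\<^sub>n\<close> is a map of the above kind; it too can be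
  refined to some \<open>u\<^sub>k\<close>, and therefore \<open>f\<close> is in the subgroup (\<open>thompson_group_generated\<close>).
\<close>

section \<open>The enveloping group of a quandle given by generators and relations\<close>

fun letter_eval :: "('b, 'c) monoid_scheme \<Rightarrow> ('a \<Rightarrow> 'b) \<Rightarrow> 'a letter \<Rightarrow> 'b" where
  "letter_eval G f (Pos x) = f x"
| "letter_eval G f (Neg x) = inv\<^bsub>G\<^esub> (f x)"

fun word_eval :: "('b, 'c) monoid_scheme \<Rightarrow> ('a \<Rightarrow> 'b) \<Rightarrow> 'a letter list \<Rightarrow> 'b" where
  "word_eval G f [] = \<one>\<^bsub>G\<^esub>"
| "word_eval G f (a # w) = letter_eval G f a \<otimes>\<^bsub>G\<^esub> word_eval G f w"

text \<open>
  Terms are evaluated in the conjugation quandle of the group.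
\<close>

fun qterm_eval :: "('b, 'c) monoid_scheme \<Rightarrow> ('a \<Rightarrow> 'b) \<Rightarrow> 'a qterm \<Rightarrow> 'b" where
  "qterm_eval G f (QGen x) = f x"
| "qterm_eval G f (QOp s t) =
    qterm_eval G f s \<otimes>\<^bsub>G\<^esub> qterm_eval G f t \<otimes>\<^bsub>G\<^esub> inv\<^bsub>G\<^esub> (qterm_eval G f s)"
| "qterm_eval G f (QInv s t) =
    inv\<^bsub>G\<^esub> (qterm_eval G f s) \<otimes>\<^bsub>G\<^esub> qterm_eval G f t \<otimes>\<^bsub>G\<^esub> qterm_eval G f s"

context group
begin

lemma mult_inv_cancel:
  "\<lbrakk>x \<in> carrier G; y \<in> carrier G\<rbrakk> \<Longrightarrow> x \<otimes> (inv x \<otimes> y) = y"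
  "\<lbrakk>x \<in> carrier G; y \<in> carrier G\<rbrakk> \<Longrightarrow> inv x \<otimes> (x \<otimes> y) = y"
  by (simp_all add: m_assoc[symmetric])

lemma letter_eval_closed:
  "f \<in> X \<rightarrow> carrier G \<Longrightarrow> [a] \<in> words X \<Longrightarrow> letter_eval G f a \<in> carrier G"
  by (cases a) (auto simp: words_def)

lemma word_eval_closed:
  "f \<in> X \<rightarrow> carrier G \<Longrightarrow> w \<in> words X \<Longrightarrow> word_eval G f w \<in> carrier G"
proof (induction w)
  case (Cons a w)
  then show ?case using words_simps(2)[of a w X] by (auto simp: letter_eval_closed)
qed simp

lemma word_eval_append:
  assumes f: "f \<in> X \<rightarrow> carrier G" and w: "w \<in> words X"
  shows "v \<in> words X \<Longrightarrow> word_eval G f (v @ w) = word_eval G f v \<otimes> word_eval G f w"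
proof (induction v)
  case Nil
  then show ?case using f w by (simp add: word_eval_closed)
next
  case (Cons a v)
  then have "[a] \<in> words X" "v \<in> words X" using words_simps(2)[of a v X] by auto
  then show ?case
    using Cons.IH f w by (simp add: m_assoc word_eval_closed letter_eval_closed)
qed

lemma word_eval_gcong:
  assumes f: "f \<in> X \<rightarrow> carrier G"
    and R: "\<And>v w. (v, w) \<in> R \<Longrightarrow> v \<in> words X \<Longrightarrow> w \<in> words X \<Longrightarrow>
      word_eval G f v = word_eval G f w"
  shows "gcong X R v w \<Longrightarrow> word_eval G f v = word_eval G f w"
proof (induction rule: gcong.induct)
  case (gcong_cancel a)
  then show ?case using f by (cases a) (auto simp: words_def Pi_iff)
next
  case (gcong_append v v' w w')
  then show ?case
    using word_eval_append[OF f] gcong_words by metis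
qed (use R in auto)

text \<open>
  The universal property of a presented group (von Dyck): generators may be sent anywhere, as long
  as the relations are respected.
\<close>

lemma presented_group_hom:
  assumes f: "f \<in> X \<rightarrow> carrier G"
    and R: "\<And>v w. (v, w) \<in> R \<Longrightarrow> v \<in> words X \<Longrightarrow> w \<in> words X \<Longrightarrow>
      word_eval G f v = word_eval G f w"
  obtains h where "h \<in> hom (presented_group X R) G"
    and "\<And>w. w \<in> words X \<Longrightarrow> h (grel X R `` {w}) = word_eval G f w"
proof
  define h where "h A = word_eval G f (SOME w. w \<in> A)" for A
  show h: "h (grel X R `` {w}) = word_eval G f w" if w: "w \<in> words X" for w
  proof -
    have "w \<in> grel X R `` {w}" using w by (simp add: grel_def gcong_refl)
    then have "(SOME v. v \<in> grel X R `` {w}) \<in> grel X R `` {w}" by (rule someI)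
    then show ?thesis
      using word_eval_gcong[OF f R] by (simp add: h_def grel_def)
  qed
  show "h \<in> hom (presented_group X R) G"
  proof (rule homI)
    fix A assume "A \<in> carrier (presented_group X R)"
    then obtain v where v: "v \<in> words X" "A = grel X R `` {v}" by (rule presented_group_cases)
    then show "h A \<in> carrier G" using f by (simp add: h word_eval_closed)
    fix B assume "B \<in> carrier (presented_group X R)"
    then obtain w where w: "w \<in> words X" "B = grel X R `` {w}" by (rule presented_group_cases)
    show "h (A \<otimes>\<^bsub>presented_group X R\<^esub> B) = h A \<otimes> h B"
      using v w f by (simp add: presented_group_mult h words_simps(3) word_eval_append)
  qed
qed

lemma qterm_eval_closed: "range f \<subseteq> carrier G \<Longrightarrow> qterm_eval G f t \<in> carrier G"
  by (induction t) auto

text \<open>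
  Every group is a quandle under conjugation, so the congruence that defines a presented quandle
  is respected as soon as its relations are.
\<close>

lemma qterm_eval_qcong:
  assumes f: "range f \<subseteq> carrier G"
    and R: "\<And>s t. (s, t) \<in> R \<Longrightarrow> qterm_eval G f s = qterm_eval G f t"
  shows "qcong R s t \<Longrightarrow> qterm_eval G f s = qterm_eval G f t"
  by (induction rule: qcong.induct)
    (simp_all add: R qterm_eval_closed[OF f] m_assoc inv_mult_group mult_inv_cancel)

end

definition Gr_class :: "('a, 'b) quandle_scheme \<Rightarrow> 'a letter list \<Rightarrow> 'a letter list set" where
  "Gr_class Q w =
    grel (carrier Q)
      {([Pos (x \<rhd>\<^bsub>Q\<^esub> y)], [Pos x, Pos y, Neg x]) | x y. x \<in> carrier Q \<and> y \<in> carrier Q}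
      `` {w}"

abbreviation Gr_gen :: "('a, 'b) quandle_scheme \<Rightarrow> 'a \<Rightarrow> 'a letter list set" where
  "Gr_gen Q x \<equiv> Gr_class Q [Pos x]"

lemma group_Gr: "group (Gr Q)"
  unfolding Gr_def by (rule group_presented_group)

lemma Gr_class_mult:
  "v \<in> words (carrier Q) \<Longrightarrow> w \<in> words (carrier Q) \<Longrightarrow>
    Gr_class Q v \<otimes>\<^bsub>Gr Q\<^esub> Gr_class Q w = Gr_class Q (v @ w)"
  unfolding Gr_class_def Gr_def by (rule presented_group_mult)

lemma Gr_one: "\<one>\<^bsub>Gr Q\<^esub> = Gr_class Q []"
  by (simp add: Gr_class_def Gr_def presented_group_def)

lemma Gr_class_closed: "w \<in> words (carrier Q) \<Longrightarrow> Gr_class Q w \<in> carrier (Gr Q)"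
  unfolding Gr_class_def Gr_def by (rule presented_group_class)

lemma letter_words: "[Pos x] \<in> words X \<longleftrightarrow> x \<in> X" "[Neg x] \<in> words X \<longleftrightarrow> x \<in> X"
  by (auto simp: words_def)

lemma Gr_gen_closed: "x \<in> carrier Q \<Longrightarrow> Gr_gen Q x \<in> carrier (Gr Q)"
  by (simp add: Gr_class_closed letter_words)

lemma Gr_class_Neg:
  assumes "x \<in> carrier Q"
  shows "Gr_class Q [Neg x] = inv\<^bsub>Gr Q\<^esub> (Gr_gen Q x)"
proof -
  interpret group "Gr Q" by (rule group_Gr)
  have N: "[Neg x] \<in> words (carrier Q)" and P: "[Pos x] \<in> words (carrier Q)"
    using assms by (simp_all add: letter_words)
  have "Gr_class Q ([Neg x] @ [Pos x]) = Gr_class Q []"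
    unfolding Gr_class_def
    using gcong_cancel[OF N] assms
    by (subst grel_class_eq) (auto simp: words_def)
  then have "Gr_class Q [Neg x] \<otimes>\<^bsub>Gr Q\<^esub> Gr_gen Q x = \<one>\<^bsub>Gr Q\<^esub>"
    by (simp only: Gr_class_mult[OF N P] Gr_one)
  then show ?thesis using inv_equality Gr_class_closed N P by metis
qed

lemma Gr_gen_op:
  assumes "quandle Q" and x: "x \<in> carrier Q" and y: "y \<in> carrier Q"
  shows "Gr_gen Q (x \<rhd>\<^bsub>Q\<^esub> y) = Gr_gen Q x \<otimes>\<^bsub>Gr Q\<^esub> Gr_gen Q y \<otimes>\<^bsub>Gr Q\<^esub> inv\<^bsub>Gr Q\<^esub> (Gr_gen Q x)"
proof -
  have "x \<rhd>\<^bsub>Q\<^esub> y \<in> carrier Q"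
    using quandle.bij_left[OF assms(1) x] y by (auto simp: bij_betw_def)
  moreover have xyx: "[Pos x, Pos y, Neg x] \<in> words (carrier Q)"
    using x y by (auto simp: words_def)
  ultimately have "Gr_gen Q (x \<rhd>\<^bsub>Q\<^esub> y) = Gr_class Q ([Pos x, Pos y] @ [Neg x])"
    unfolding Gr_class_def using x y xyx
    by (subst grel_class_eq) (auto simp: letter_words intro: gcong_relation)
  also have "\<dots> = Gr_class Q ([Pos x] @ [Pos y]) \<otimes>\<^bsub>Gr Q\<^esub> Gr_class Q [Neg x]"
    using x y by (subst Gr_class_mult) (auto simp: words_def)
  also have "\<dots> = Gr_gen Q x \<otimes>\<^bsub>Gr Q\<^esub> Gr_gen Q y \<otimes>\<^bsub>Gr Q\<^esub> inv\<^bsub>Gr Q\<^esub> (Gr_gen Q x)"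
    using x y by (simp only: Gr_class_mult[symmetric] letter_words Gr_class_Neg)
  finally show ?thesis .
qed

lemma Gr_generated:
  assumes H: "subgroup H (Gr Q)" and gen: "\<And>x. x \<in> carrier Q \<Longrightarrow> Gr_gen Q x \<in> H"
  shows "H = carrier (Gr Q)"
proof -
  interpret H: subgroup H "Gr Q" by (rule H)
  interpret G: group "Gr Q" by (rule group_Gr)
  have "Gr_class Q w \<in> H" if "w \<in> words (carrier Q)" for w
    using that
  proof (induction w)
    case Nil
    then show ?case by (simp flip: Gr_one)
  next
    case (Cons a w)
    then have aw: "[a] \<in> words (carrier Q)" "w \<in> words (carrier Q)"
      using words_simps(2)[of a w "carrier Q"] by auto
    then have "Gr_class Q [a] \<in> H"
      using gen by (cases a) (auto simp: letter_words Gr_class_Neg)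
    then show ?case
      using Gr_class_mult[OF aw] Cons.IH[OF aw(2)] by (metis H.m_closed append.simps)
  qed
  then have "carrier (Gr Q) \<subseteq> H"
    unfolding Gr_class_def Gr_def by (auto elim!: presented_group_cases)
  then show ?thesis using H.subset by blast
qed

text \<open>
  The generators of the enveloping group of a presented quandle that come from the generators of
  the quandle. The lemmas below say that they present this group, each quandle relation being read
  as a relation between conjugates.
\<close>

abbreviation Gr_presented_gen :: "('a qterm \<times> 'a qterm) set \<Rightarrow> 'a \<Rightarrow> 'a qterm set letter list set" where
  "Gr_presented_gen R a \<equiv> Gr_gen (presented_quandle R) (qrel R `` {QGen a})"

text \<open>
  Two universal properties are composed: values for the quandle generators extend to the presented
  quandle, with values in the conjugation quandle of \<open>K\<close>, and then from the elements of that
  quandle, which generate the enveloping group, to the group itself.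
\<close>

lemma Gr_presented_quandle_hom:
  assumes "group K" and f: "range f \<subseteq> carrier K"
    and R: "\<And>s t. (s, t) \<in> R \<Longrightarrow> qterm_eval K f s = qterm_eval K f t"
  obtains h where "h \<in> hom (Gr (presented_quandle R)) K" and "\<And>a. h (Gr_presented_gen R a) = f a"
proof -
  interpret group K by fact
  let ?Q = "presented_quandle R"
  define q where "q A = qterm_eval K f (SOME t. t \<in> A)" for A
  have q: "q (qrel R `` {t}) = qterm_eval K f t" for t
  proof -
    have "t \<in> qrel R `` {t}" by (simp add: qrel_def qcong_refl)
    then have "(SOME s. s \<in> qrel R `` {t}) \<in> qrel R `` {t}" by (rule someI)
    then show ?thesis
      using qterm_eval_qcong[OF f R] by (simp add: q_def qrel_def)
  qed
  have qc: "q A \<in> carrier K" if "A \<in> carrier ?Q" for A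
    using that by (auto elim!: presented_quandle_cases simp: q qterm_eval_closed[OF f])
  obtain h where h: "h \<in> hom (Gr ?Q) K"
    "\<And>w. w \<in> words (carrier ?Q) \<Longrightarrow> h (Gr_class ?Q w) = word_eval K q w"
    unfolding Gr_def Gr_class_def
  proof (rule presented_group_hom[of q "carrier ?Q"])
    show "q \<in> carrier ?Q \<rightarrow> carrier K" using qc by blast
    fix v w assume "(v, w) \<in> {([Pos (x \<rhd>\<^bsub>?Q\<^esub> y)], [Pos x, Pos y, Neg x]) | x y.
      x \<in> carrier ?Q \<and> y \<in> carrier ?Q}"
    then obtain x y where xy: "v = [Pos (x \<rhd>\<^bsub>?Q\<^esub> y)]" "w = [Pos x, Pos y, Neg x]"
      "x \<in> carrier ?Q" "y \<in> carrier ?Q" by blast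
    then obtain s t where "x = qrel R `` {s}" "y = qrel R `` {t}"
      by (metis presented_quandle_cases)
    then show "word_eval K q v = word_eval K q w"
      using qterm_eval_closed[OF f] by (simp add: xy presented_quandle_qop q m_assoc)
  qed (use that in blast)
  show ?thesis
  proof (rule that[OF h(1)])
    show "h (Gr_presented_gen R a) = f a" for a
      using f by (simp add: h(2) q letter_words presented_quandle_class range_subsetD[OF f])
  qed
qed

lemma Gr_presented_quandle_op:
  "Gr_gen (presented_quandle R) (qrel R `` {QOp s t}) =
    Gr_gen (presented_quandle R) (qrel R `` {s}) \<otimes>\<^bsub>Gr (presented_quandle R)\<^esub>
    Gr_gen (presented_quandle R) (qrel R `` {t}) \<otimes>\<^bsub>Gr (presented_quandle R)\<^esub>
    inv\<^bsub>Gr (presented_quandle R)\<^esub> (Gr_gen (presented_quandle R) (qrel R `` {s}))"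
  using Gr_gen_op[OF quandle_presented_quandle presented_quandle_class presented_quandle_class, of R s t]
  by (simp only: presented_quandle_qop)

text \<open>
  By induction on terms: \<open>QOp s t\<close> and \<open>QInv s t\<close> become the conjugates of \<open>t\<close> by \<open>s\<close> and by
  the inverse of \<open>s\<close>.
\<close>

lemma Gr_presented_quandle_generated:
  assumes H: "subgroup H (Gr (presented_quandle R))" and gen: "range (Gr_presented_gen R) \<subseteq> H"
  shows "H = carrier (Gr (presented_quandle R))"
proof (rule Gr_generated[OF H])
  let ?G = "Gr (presented_quandle R)"
  let ?g = "\<lambda>t. Gr_gen (presented_quandle R) (qrel R `` {t})"
  interpret G: group ?G by (rule group_Gr)
  interpret H: subgroup H ?G by (rule H)
  have gc: "?g t \<in> carrier ?G" for t by (simp add: Gr_gen_closed presented_quandle_class)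
  have gH: "?g t \<in> H" for t
  proof (induction t)
    case (QGen a)
    then show ?case using gen by auto
  next
    case (QOp s t)
    then show ?case by (simp add: Gr_presented_quandle_op)
  next
    case (QInv s t)
    have "qrel R `` {t} = qrel R `` {QOp s (QInv s t)}"
      by (simp add: qrel_class_eq qcong_sym[OF qcong_op_inv])
    then have "?g t = ?g s \<otimes>\<^bsub>?G\<^esub> ?g (QInv s t) \<otimes>\<^bsub>?G\<^esub> inv\<^bsub>?G\<^esub> (?g s)"
      by (simp only: Gr_presented_quandle_op)
    then have "?g (QInv s t) = inv\<^bsub>?G\<^esub> (?g s) \<otimes>\<^bsub>?G\<^esub> ?g t \<otimes>\<^bsub>?G\<^esub> ?g s"
      using gc by (simp add: G.m_assoc G.mult_inv_cancel)
    then show ?case using QInv by simp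
  qed
  show "Gr_gen (presented_quandle R) A \<in> H" if "A \<in> carrier (presented_quandle R)" for A
    using that gH by (auto elim!: presented_quandle_cases)
qed

section \<open>Groups with the relations of Thompson's group\<close>

lemma words_UNIV: "w \<in> words UNIV"
proof -
  have "a \<in> range Pos \<union> range Neg" for a :: "'a letter" by (cases a) auto
  then show ?thesis by (auto simp: words_def)
qed

text \<open>
  The relations of the standard infinite presentation, in the form in which they move letters past
  each other. Elements of the form \<open>pos u\<close> below are the positive words.
\<close>

locale thompson_relations = group G for G (structure) +
  fixes x :: "nat \<Rightarrow> 'a"
  assumes x_closed: "x k \<in> carrier G"
    and x_relation: "j < k \<Longrightarrow> x j \<otimes> x k = x (Suc k) \<otimes> x j"
begin

abbreviation pos :: "nat list \<Rightarrow> 'a" where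
  "pos u \<equiv> word_eval G x (map Pos u)"

lemma word_closed: "word_eval G x w \<in> carrier G"
  by (rule word_eval_closed[OF _ words_UNIV]) (simp add: x_closed)

lemma pos_append: "word_eval G x (v @ w) = word_eval G x v \<otimes> word_eval G x w"
  by (rule word_eval_append[OF _ words_UNIV words_UNIV]) (simp add: x_closed)

lemmas closed = x_closed word_closed

text \<open>
  An inverse letter can be moved to the left through a positive word:
  \<open>x\<^sub>j x\<^sub>k\<^sup>-\<^sup>1\<close> is \<open>x\<^sub>k\<^sub>+\<^sub>1\<^sup>-\<^sup>1 x\<^sub>j\<close> if \<open>j < k\<close>, it is \<open>x\<^sub>k\<^sup>-\<^sup>1 x\<^sub>j\<^sub>+\<^sub>1\<close> if \<open>j > k\<close>, and it
  cancels if \<open>j = k\<close>. The index of the travelling letter changes, hence the induction is for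
  all \<open>k\<close>. For \<open>x\<^sub>j\<^sup>-\<^sup>1 x\<^sub>j\<^sub>+\<^sub>1\<close> the relations give no such rule, which is why the fractions
  below have their denominators on the left.
\<close>

lemma pos_mult_inv_gen: "\<exists>v u'. pos u \<otimes> inv (x k) = inv (pos v) \<otimes> pos u'"
proof (induction u arbitrary: k rule: rev_induct)
  case Nil
  have "pos [] \<otimes> inv (x k) = inv (pos [k]) \<otimes> pos []" by (simp add: closed)
  then show ?case by blast
next
  case (snoc j u)
  have eq: "pos (u @ [j]) \<otimes> inv (x k) = pos u \<otimes> (x j \<otimes> inv (x k))"
    by (simp add: pos_append closed m_assoc)
  consider "j < k" | "j = k" | "k < j" by linarith
  then show ?case
  proof cases
    case 1
    have "x j \<otimes> inv (x k) = inv (x (Suc k)) \<otimes> (x (Suc k) \<otimes> x j) \<otimes> inv (x k)"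
      by (simp add: closed m_assoc mult_inv_cancel)
    also have "\<dots> = inv (x (Suc k)) \<otimes> x j"
      by (simp add: closed m_assoc flip: x_relation[OF 1])
    finally have *: "pos (u @ [j]) \<otimes> inv (x k) = (pos u \<otimes> inv (x (Suc k))) \<otimes> x j"
      unfolding eq by (simp add: closed m_assoc)
    obtain v u' where v: "pos u \<otimes> inv (x (Suc k)) = inv (pos v) \<otimes> pos u'" using snoc by blast
    have "pos (u @ [j]) \<otimes> inv (x k) = inv (pos v) \<otimes> pos (u' @ [j])"
      unfolding * v by (simp add: pos_append closed m_assoc)
    then show ?thesis by blast
  next
    case 2
    have "pos (u @ [j]) \<otimes> inv (x k) = inv (pos []) \<otimes> pos u"
      unfolding eq using 2 by (simp add: closed)
    then show ?thesis by blast
  next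
    case 3
    have "x j \<otimes> inv (x k) = inv (x k) \<otimes> (x k \<otimes> x j) \<otimes> inv (x k)"
      by (simp add: closed m_assoc mult_inv_cancel)
    also have "\<dots> = inv (x k) \<otimes> x (Suc j)"
      by (simp add: closed m_assoc x_relation[OF 3])
    finally have *: "pos (u @ [j]) \<otimes> inv (x k) = (pos u \<otimes> inv (x k)) \<otimes> x (Suc j)"
      unfolding eq by (simp add: closed m_assoc)
    obtain v u' where v: "pos u \<otimes> inv (x k) = inv (pos v) \<otimes> pos u'" using snoc by blast
    have "pos (u @ [j]) \<otimes> inv (x k) = inv (pos v) \<otimes> pos (u' @ [Suc j])"
      unfolding * v by (simp add: pos_append closed m_assoc)
    then show ?thesis by blast
  qed
qed

lemma pos_mult_inv_pos: "\<exists>v u'. pos u \<otimes> inv (pos w) = inv (pos v) \<otimes> pos u'"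
proof (induction w)
  case Nil
  have "pos u \<otimes> inv (pos []) = inv (pos []) \<otimes> pos u" by (simp add: closed)
  then show ?case by blast
next
  case (Cons k w)
  then obtain v u' where 1: "pos u \<otimes> inv (pos w) = inv (pos v) \<otimes> pos u'" by blast
  obtain v' u'' where 2: "pos u' \<otimes> inv (x k) = inv (pos v') \<otimes> pos u''"
    using pos_mult_inv_gen by blast
  have "pos u \<otimes> inv (pos (k # w)) = pos u \<otimes> inv (pos w) \<otimes> inv (x k)"
    by (simp add: inv_mult_group closed m_assoc)
  also have "\<dots> = inv (pos v) \<otimes> (pos u' \<otimes> inv (x k))"
    by (simp add: 1 closed m_assoc)
  also have "\<dots> = inv (pos (v' @ v)) \<otimes> pos u''"
    by (simp add: 2 pos_append inv_mult_group closed m_assoc)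
  finally show ?case by blast
qed

text \<open>
  The positive words satisfy the Ore condition, by the previous lemma, so their left fractions are
  closed under multiplication. Hence they exhaust the group if it is generated by the \<open>x\<^sub>k\<close>.
\<close>

lemma subgroup_fractions: "subgroup {inv (pos u) \<otimes> pos v | u v. True} G"
proof (rule subgroupI)
  let ?H = "{inv (pos u) \<otimes> pos v | u v. True}"
  show "?H \<subseteq> carrier G" by (auto simp: closed)
  show "?H \<noteq> {}" by blast
  fix g assume "g \<in> ?H"
  then obtain u v where g: "g = inv (pos u) \<otimes> pos v" by blast
  have "inv g = inv (pos v) \<otimes> pos u" by (simp add: g inv_mult_group closed)
  then show "inv g \<in> ?H" by blast
  fix h assume "h \<in> ?H"
  then obtain u' v' where h: "h = inv (pos u') \<otimes> pos v'" by blast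
  obtain w z where w: "pos v \<otimes> inv (pos u') = inv (pos w) \<otimes> pos z"
    using pos_mult_inv_pos by blast
  have "g \<otimes> h = inv (pos u) \<otimes> (pos v \<otimes> inv (pos u')) \<otimes> pos v'"
    by (simp add: g h closed m_assoc)
  also have "\<dots> = inv (pos (w @ u)) \<otimes> pos (z @ v')"
    by (simp add: w pos_append inv_mult_group closed m_assoc)
  finally show "g \<otimes> h \<in> ?H" by blast
qed

lemma gen_mult_pos:
  "\<forall>k\<in>set u. i < k \<Longrightarrow> x i \<otimes> pos u = pos (map Suc u) \<otimes> x i"
proof (induction u)
  case (Cons k u)
  have "x i \<otimes> pos (k # u) = (x i \<otimes> x k) \<otimes> pos u" by (simp add: closed m_assoc)
  also have "\<dots> = x (Suc k) \<otimes> (x i \<otimes> pos u)" 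
    using Cons.prems by (simp add: x_relation closed m_assoc)
  also have "\<dots> = x (Suc k) \<otimes> (pos (map Suc u) \<otimes> x i)" using Cons by simp
  finally show ?case by (simp add: closed m_assoc del: map_map)
qed (simp add: closed)

text \<open>
  An occurrence of the least letter can be pushed to the right end; each larger letter that it
  passes has its index raised by one, which does not change the length of the word.
\<close>

lemma pos_least_letter_last:
  "i \<in> set u \<Longrightarrow> \<forall>k\<in>set u. i \<le> k \<Longrightarrow> \<exists>u'. length u = Suc (length u') \<and> pos u = pos u' \<otimes> x i"
proof (induction u)
  case (Cons k u)
  show ?case
  proof (cases "i \<in> set u")
    case True
    then obtain u' where u': "length u = Suc (length u')" "pos u = pos u' \<otimes> x i"
      using Cons by auto
    then have "pos (k # u) = pos (k # u') \<otimes> x i" by (simp add: closed m_assoc)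
    then show ?thesis using u'(1) by (intro exI[of _ "k # u'"]) simp
  next
    case False
    then have "k = i" "\<forall>j\<in>set u. i < j" using Cons.prems by (auto simp: order_less_le)
    then have "pos (k # u) = pos (map Suc u) \<otimes> x i" by (simp add: gen_mult_pos)
    then show ?thesis by (intro exI[of _ "map Suc u"]) simp
  qed
qed simp

end

text \<open>
  The assumption \<open>separated\<close> is what makes a homomorphism injective: in the target group, the
  value of a positive word shows which letter is its least one.
\<close>

locale thompson_relations_hom =
  G: thompson_relations G x + K: thompson_relations K y
  for G (structure) and x and K (structure) and y +
  fixes h
  assumes hom: "h \<in> hom G K" and h_x: "h (x k) = y k"
    and generators: "subgroup H G \<Longrightarrow> range x \<subseteq> H \<Longrightarrow> H = carrier G"
    and separated: "\<lbrakk>i \<in> set u; \<forall>k\<in>set v. i < k\<rbrakk> \<Longrightarrow> K.pos u \<noteq> K.pos v"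
begin

lemma h_pos: "h (G.pos u) = K.pos u"
proof -
  interpret h: group_hom G K h by unfold_locales (rule hom)
  show ?thesis by (induction u) (auto simp: h_x G.closed)
qed

text \<open>
  Two words with the same value in the target have the same least letter. In both, this letter can
  be brought to the right end and cancelled, which leaves shorter words.
\<close>

lemma pos_eq: "K.pos u = K.pos v \<Longrightarrow> G.pos u = G.pos v"
proof (induction "length u + length v" arbitrary: u v rule: less_induct)
  case less
  show ?case
  proof (cases "u = [] \<and> v = []")
    case False
    \<comment> \<open>a word that lacks \<open>i\<close> has only larger letters, and would be separated from the other word\<close>
    define i where "i = Min (set u \<union> set v)"
    have "i \<in> set u \<union> set v" unfolding i_def by (rule Min_in) (use False in auto)
    moreover have le: "\<forall>k\<in>set u \<union> set v. i \<le> k" by (simp add: i_def)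
    ultimately have "i \<in> set u" "i \<in> set v"
      using separated[of i u v] separated[of i v u] less.prems
      by (auto simp: order_less_le)
    have "i \<in> set u" "\<forall>k\<in>set u. i \<le> k" "i \<in> set v" "\<forall>k\<in>set v. i \<le> k"
      using le \<open>i \<in> set u\<close> \<open>i \<in> set v\<close> by auto
    then obtain u' v' where
      u': "length u = Suc (length u')" "G.pos u = G.pos u' \<otimes>\<^bsub>G\<^esub> x i" and
      v': "length v = Suc (length v')" "G.pos v = G.pos v' \<otimes>\<^bsub>G\<^esub> x i"
      by (metis G.pos_least_letter_last)
    have "K.pos w = K.pos w' \<otimes>\<^bsub>K\<^esub> y i" if "G.pos w = G.pos w' \<otimes>\<^bsub>G\<^esub> x i" for w w'
      using hom_mult[OF hom, of "G.pos w'" "x i"] that[symmetric]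
      by (simp add: h_pos h_x G.closed)
    from this[OF u'(2)] this[OF v'(2)]
    have "K.pos u' = K.pos v'" using less.prems by (simp add: K.closed)
    then show ?thesis using less.hyps[of u' v'] u' v' by simp
  qed simp
qed

lemma inj: "inj_on h (carrier G)"
proof -
  interpret h: group_hom G K h by unfold_locales (rule hom)
  have "g = \<one>\<^bsub>G\<^esub>" if g: "g \<in> carrier G" "h g = \<one>\<^bsub>K\<^esub>" for g
  proof -
    let ?H = "{inv\<^bsub>G\<^esub> (G.pos u) \<otimes>\<^bsub>G\<^esub> G.pos v | u v. True}"
    have "x k \<in> ?H" for k
      by (rule CollectI, rule exI[of _ "[]"], rule exI[of _ "[k]"]) (simp add: G.closed)
    then have "?H = carrier G" by (intro generators G.subgroup_fractions) blast
    then obtain u v where uv: "g = inv\<^bsub>G\<^esub> (G.pos u) \<otimes>\<^bsub>G\<^esub> G.pos v" using g(1) by blast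
    then have "inv\<^bsub>K\<^esub> (K.pos u) \<otimes>\<^bsub>K\<^esub> K.pos v = \<one>\<^bsub>K\<^esub>"
      using g(2) by (simp add: G.closed h_pos)
    then have "K.pos u = K.pos v"
      using K.inv_equality K.closed by (metis K.inv_closed K.inv_inv)
    then show ?thesis by (simp add: uv pos_eq[of u v] G.closed)
  qed
  then show ?thesis by (simp add: h.inj_on_one_iff)
qed

end

section \<open>Dyadic rationals\<close>

text \<open>
  The filter form makes it easy to choose one power of two that clears finitely many denominators.
\<close>

lemma dyadic_rationals_iff_eventually:
  "x \<in> dyadic_rationals \<longleftrightarrow> (\<forall>\<^sub>F n in sequentially. 2 ^ n * x \<in> \<int>)"
proof
  assume "x \<in> dyadic_rationals"
  then obtain a :: int and k where x: "x = of_int a / 2 ^ k" by (auto simp: dyadic_rationals_def)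
  have "2 ^ n * x = of_int (2 ^ (n - k) * a)" if "n \<ge> k" for n
  proof -
    have "(2::real) ^ n = 2 ^ (n - k) * 2 ^ k" using that by (simp flip: power_add)
    then show ?thesis by (simp add: x)
  qed
  then show "\<forall>\<^sub>F n in sequentially. 2 ^ n * x \<in> \<int>"
    unfolding eventually_sequentially by (metis Ints_of_int)
next
  assume "\<forall>\<^sub>F n in sequentially. 2 ^ n * x \<in> \<int>"
  then obtain n where "2 ^ n * x \<in> \<int>" by (auto simp: eventually_sequentially)
  then obtain a where "2 ^ n * x = of_int a" by (auto elim: Ints_cases)
  then have "x = of_int a / 2 ^ n" by (simp add: field_simps)
  then show "x \<in> dyadic_rationals" by (auto simp: dyadic_rationals_def)
qed

lemma dyadic_of_int: "of_int a \<in> dyadic_rationals"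
  by (simp add: dyadic_rationals_iff_eventually)

lemma dyadic_of_nat: "of_nat a \<in> dyadic_rationals"
  by (simp add: dyadic_rationals_iff_eventually)

lemma dyadic_add: "x \<in> dyadic_rationals \<Longrightarrow> y \<in> dyadic_rationals \<Longrightarrow> x + y \<in> dyadic_rationals"
  unfolding dyadic_rationals_iff_eventually
  by (erule (1) eventually_elim2) (simp add: distrib_left)

lemma dyadic_diff: "x \<in> dyadic_rationals \<Longrightarrow> y \<in> dyadic_rationals \<Longrightarrow> x - y \<in> dyadic_rationals"
  unfolding dyadic_rationals_iff_eventually
  by (erule (1) eventually_elim2) (simp add: right_diff_distrib)

lemma dyadic_divide: "x \<in> dyadic_rationals \<Longrightarrow> x / 2 ^ k \<in> dyadic_rationals"
proof -
  assume "x \<in> dyadic_rationals"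
  then obtain a :: int and n where "x = of_int a / 2 ^ n" by (auto simp: dyadic_rationals_def)
  then have "x / 2 ^ k = of_int a / 2 ^ (n + k)" by (simp add: power_add)
  then show ?thesis unfolding dyadic_rationals_def by blast
qed

lemma dyadic_mult: "x \<in> dyadic_rationals \<Longrightarrow> 2 ^ k * x \<in> dyadic_rationals"
proof -
  assume "x \<in> dyadic_rationals"
  then obtain a :: int and n where "x = of_int a / 2 ^ n" by (auto simp: dyadic_rationals_def)
  then have "2 ^ k * x = of_int (2 ^ k * a) / 2 ^ n" by simp
  then show ?thesis unfolding dyadic_rationals_def by blast
qed

lemma dyadic_powi: "x \<in> dyadic_rationals \<Longrightarrow> 2 powi m * x \<in> dyadic_rationals"
  using dyadic_mult[of x "nat m"] dyadic_divide[of x "nat (- m)"]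
  by (auto simp: power_int_def field_simps)

lemmas dyadic_intros =
  dyadic_of_int dyadic_of_nat dyadic_add dyadic_diff dyadic_divide dyadic_mult dyadic_powi

section \<open>Thompson's group is a group\<close>

lemma dyadic_piecewise_linearI:
  assumes "finite B" "B \<subseteq> dyadic_rationals"
    and "\<And>a b. \<lbrakk>0 \<le> a; a < b; b \<le> 1; {a<..<b} \<inter> B = {}\<rbrakk> \<Longrightarrow>
      \<exists>(m :: int) (c :: real). \<forall>t\<in>{a<..<b}. f t = 2 powi m * t + c"
  shows "dyadic_piecewise_linear f"
  unfolding dyadic_piecewise_linear_def
  by (intro exI[of _ B] conjI allI impI assms(1,2)) (elim conjE, rule assms(3))

text \<open>
  For an increasing self-map of the interval, being a homeomorphism amounts to being continuous and
  fixing both end points: surjectivity is the intermediate value theorem, and the inverse is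
  continuous by compactness.
\<close>

lemma thompson_group_iff:
  "f \<in> carrier thompson_group \<longleftrightarrow>
    f \<in> extensional {0..1} \<and> continuous_on {0..1} f \<and> strict_mono_on {0..1} f \<and>
    f 0 = 0 \<and> f 1 = 1 \<and> dyadic_piecewise_linear f"
proof
  assume "f \<in> carrier thompson_group"
  then have f: "f \<in> extensional {0..1}" "f ` {0..1} = {0..1}" "strict_mono_on {0..1} f"
    "dyadic_piecewise_linear f" and "\<exists>g. homeomorphism {0..1} {0..1} f g"
    by (auto simp: thompson_group_def Bij_def bij_betw_def)
  then have cont: "continuous_on {0..1} f" by (auto simp: homeomorphism_def)
  have mono: "f x \<le> f y" if "0 \<le> x" "x \<le> y" "y \<le> 1" for x y
    using strict_mono_on_leD[OF f(3), of x y] that by simp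
  have "0 \<in> f ` {0..1}" "1 \<in> f ` {0..1}" unfolding f(2) by auto
  then obtain x y where xy: "x \<in> {0..1}" "f x = 0" "y \<in> {0..1}" "f y = 1" by force
  have "f 0 \<in> {0..1}" "f 1 \<in> {0..1}" using f(2) by auto
  then have "f 0 = 0" "f 1 = 1"
    using mono[of 0 x] mono[of y 1] xy by auto
  then show "f \<in> extensional {0..1} \<and> continuous_on {0..1} f \<and> strict_mono_on {0..1} f \<and>
    f 0 = 0 \<and> f 1 = 1 \<and> dyadic_piecewise_linear f" using f cont by auto
next
  assume f: "f \<in> extensional {0..1} \<and> continuous_on {0..1} f \<and> strict_mono_on {0..1} f \<and>
    f 0 = 0 \<and> f 1 = 1 \<and> dyadic_piecewise_linear f"
  have mono: "f x \<le> f y" if "0 \<le> x" "x \<le> y" "y \<le> 1" for x y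
    using strict_mono_on_leD[of "{0..1}" f x y] f that by simp
  have inj: "inj_on f {0..1}" using f strict_mono_on_imp_inj_on by blast
  have "f ` {0..1} = {0..1}"
  proof (intro equalityI subsetI)
    fix y assume "y \<in> f ` {0..1}"
    then obtain x where "x \<in> {0..1}" "y = f x" by blast
    then show "y \<in> {0..1}" using mono[of 0 x] mono[of x 1] f by simp
  next
    fix y :: real assume "y \<in> {0..1}"
    then obtain x where "0 \<le> x" "x \<le> 1" "f x = y" using IVT'[of f 0 y 1] f by auto
    then show "y \<in> f ` {0..1}" by auto
  qed
  moreover from this obtain g where "homeomorphism {0..1} {0..1} f g"
    using homeomorphism_compact[of "{0..1}" f "{0..1}"] f inj by auto
  ultimately show "f \<in> carrier thompson_group"
    using f inj by (auto simp: thompson_group_def Bij_def bij_betw_def)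
qed

lemma thompson_group_eqI:
  "\<lbrakk>f \<in> carrier thompson_group; g \<in> carrier thompson_group; \<And>t. t \<in> {0..1} \<Longrightarrow> f t = g t\<rbrakk> \<Longrightarrow> f = g"
  by (rule extensionalityI[of _ "{0..1}"]) (auto simp: thompson_group_iff)

lemma thompson_group_less_iff:
  assumes "f \<in> carrier thompson_group" "x \<in> {0..1}" "y \<in> {0..1}"
  shows "f x < f y \<longleftrightarrow> x < y"
  using assms strict_mono_onD[of "{0..1}" f x y] strict_mono_onD[of "{0..1}" f y x]
  by (cases x y rule: linorder_cases) (auto simp: thompson_group_iff)

lemma thompson_group_in_unit:
  assumes "f \<in> carrier thompson_group" "x \<in> {0..1}"
  shows "f x \<in> {0..1}"
  using assms thompson_group_less_iff[of f x 0] thompson_group_less_iff[of f 1 x]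
  by (auto simp: thompson_group_iff)

lemma thompson_group_Bij: "f \<in> carrier thompson_group \<Longrightarrow> f \<in> Bij {0..1}"
  by (simp add: thompson_group_def)

lemma thompson_group_surj:
  assumes "f \<in> carrier thompson_group" "y \<in> {0..1}"
  obtains x where "x \<in> {0..1}" "f x = y"
proof -
  have "f ` {0..1} = {0..1}" using thompson_group_Bij[OF assms(1)] by (simp add: Bij_def bij_betw_def)
  then have "y \<in> f ` {0..1}" using assms(2) by simp
  then show ?thesis using that by blast
qed

text \<open>
  By continuity the affine formulas extend to the end points of each interval.
\<close>

lemma thompson_group_affine_piece:
  assumes f: "f \<in> carrier thompson_group"
  obtains B where "finite B" "B \<subseteq> dyadic_rationals"
    "\<And>a b. \<lbrakk>0 \<le> a; a < b; b \<le> 1; {a<..<b} \<inter> B = {}\<rbrakk> \<Longrightarrow>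
      \<exists>m c. \<forall>t\<in>{a..b}. f t = 2 powi m * t + c"
proof -
  obtain B where B: "finite B" "B \<subseteq> dyadic_rationals" and
    aff: "\<forall>a b. 0 \<le> a \<and> a < b \<and> b \<le> 1 \<and> {a<..<b} \<inter> B = {} \<longrightarrow>
      (\<exists>(m :: int) (c :: real). \<forall>t\<in>{a<..<b}. f t = 2 powi m * t + c)"
    using f unfolding thompson_group_iff dyadic_piecewise_linear_def
    by (elim conjE exE) (rule that)
  have "\<exists>m c. \<forall>t\<in>{a..b}. f t = 2 powi m * t + c"
    if ab: "0 \<le> a" "a < b" "b \<le> 1" "{a<..<b} \<inter> B = {}" for a b
  proof -
    obtain m c where mc: "\<forall>t\<in>{a<..<b}. f t = 2 powi m * t + c" using aff ab by metis
    have "continuous_on {0..1} f" using f by (simp add: thompson_group_iff)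
    then have "continuous_on (closure {a<..<b}) (\<lambda>t. f t - 2 powi m * t)"
      using ab by (auto intro!: continuous_intros elim: continuous_on_subset)
    then have "f t - 2 powi m * t = c" if "t \<in> {a..b}" for t
      by (rule continuous_constant_on_closure) (use mc ab that in auto)
    then have "\<forall>t\<in>{a..b}. f t = 2 powi m * t + c" by (metis add.commute diff_add_cancel)
    then show ?thesis by blast
  qed
  with B show ?thesis by (rule that)
qed

text \<open>
  The map \<open>f\<close> carries the standard dyadic interval \<open>[i / 2\<^sup>n, (i + 1) / 2\<^sup>n]\<close> affinely onto the
  standard dyadic interval \<open>[a / 2\<^sup>l, (a + 1) / 2\<^sup>l]\<close>.
\<close>

definition dyadic_piece :: "(real \<Rightarrow> real) \<Rightarrow> nat \<Rightarrow> nat \<Rightarrow> int \<Rightarrow> nat \<Rightarrow> bool" where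
  "dyadic_piece f n i a l \<longleftrightarrow>
    (\<forall>t\<in>{real i / 2 ^ n..(real i + 1) / 2 ^ n}. f t = (of_int a + (2 ^ n * t - real i)) / 2 ^ l)"

lemma dyadic_piece_cover:
  assumes "t \<in> {0..1::real}"
  obtains i where "i < 2 ^ n" "t \<in> {real i / 2 ^ n..(real i + 1) / 2 ^ n}"
proof (cases "t = 1")
  case True
  have "real (2 ^ n - 1) = 2 ^ n - 1" by (simp add: of_nat_diff)
  then have "t \<in> {real (2 ^ n - 1) / 2 ^ n..(real (2 ^ n - 1) + 1) / 2 ^ n}"
    by (simp only: True) simp
  then show ?thesis using that[of "2 ^ n - 1"] by simp
next
  case False
  define i where "i = nat \<lfloor>2 ^ n * t\<rfloor>"
  have i: "real i = of_int \<lfloor>2 ^ n * t\<rfloor>" using assms by (simp add: i_def)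
  then have "real i \<le> 2 ^ n * t" "2 ^ n * t \<le> real i + 1" by linarith+
  then have "t \<in> {real i / 2 ^ n..(real i + 1) / 2 ^ n}" by (simp add: field_simps)
  moreover have "2 ^ n * t < 2 ^ n" using assms False by simp
  then have "real i < real (2 ^ n)" using \<open>real i \<le> 2 ^ n * t\<close> by (metis le_less_trans of_nat_numeral of_nat_power)
  then have "i < 2 ^ n" by (simp only: of_nat_less_iff)
  ultimately show ?thesis using that by blast
qed

text \<open>
  The structure theorem for elements of Thompson's group. First choose \<open>N\<close> so that no breakpoint
  lies inside an interval \<open>[k / 2\<^sup>N, (k + 1) / 2\<^sup>N]\<close>; on it, \<open>f\<close> has the form
  \<open>t \<mapsto> 2\<^sup>m t + c\<close>. Since \<open>f 0 = 0\<close>, moving from one interval to the next shows that all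
  these constants \<open>c\<close> are dyadic. A subinterval of length \<open>2\<^sup>-\<^sup>n\<close> that starts at \<open>i / 2\<^sup>n\<close> is mapped
  to an interval of length \<open>2\<^sup>-\<^sup>l\<close> with \<open>l = n - m\<close> that starts at \<open>(i + 2\<^sup>l c) / 2\<^sup>l\<close>, and
  this is a standard dyadic interval as soon as \<open>n\<close> is so large that \<open>l \<ge> 0\<close> and \<open>2\<^sup>l c\<close> is an
  integer, for each of the finitely many pairs \<open>(m, c)\<close>.
\<close>

lemma thompson_group_dyadic_pieces:
  assumes f: "f \<in> carrier thompson_group"
  shows "\<exists>n. \<forall>i<2 ^ n. \<exists>a l. dyadic_piece f n i a l"
proof -
  obtain B where B: "finite B" "B \<subseteq> dyadic_rationals" and
    aff: "\<And>a b. \<lbrakk>0 \<le> a; a < b; b \<le> 1; {a<..<b} \<inter> B = {}\<rbrakk> \<Longrightarrow>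
      \<exists>m c. \<forall>t\<in>{a..b}. f t = 2 powi m * t + c"
    using that by (rule thompson_group_affine_piece[OF f])
  have "\<forall>\<^sub>F n in sequentially. \<forall>b\<in>B. 2 ^ n * b \<in> \<int>"
    using B by (intro eventually_ball_finite) (auto simp flip: dyadic_rationals_iff_eventually)
  then obtain N where N: "\<And>b. b \<in> B \<Longrightarrow> 2 ^ N * b \<in> \<int>"
    by (auto simp: eventually_sequentially)
  define p where "p k = real k / 2 ^ N" for k
  have p: "0 \<le> p k" "p k < p (Suc k)" for k by (simp_all add: p_def divide_strict_right_mono)
  have p1: "p (Suc k) \<le> 1" if "k < 2 ^ N" for k
  proof -
    have "real (Suc k) \<le> real (2 ^ N)" using that by (simp only: of_nat_le_iff)
    then show ?thesis by (simp add: p_def)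
  qed
  have "\<exists>m c. \<forall>t\<in>{p k..p (Suc k)}. f t = 2 powi m * t + c" if k: "k < 2 ^ N" for k
  proof (rule aff[OF p p1[OF k]])
    have False if b: "b \<in> B" "p k < b" "b < p (Suc k)" for b
    proof -
      obtain z where z: "2 ^ N * b = of_int z" using N[OF b(1)] by (auto elim: Ints_cases)
      have "real k < 2 ^ N * b" "2 ^ N * b < real (Suc k)" using b by (simp_all add: p_def field_simps)
      then have "int k < z" "z < int k + 1" unfolding z by linarith+
      then show False by simp
    qed
    then show "{p k<..<p (Suc k)} \<inter> B = {}" by auto
  qed
  then obtain m c where mc: "\<And>k t. \<lbrakk>k < 2 ^ N; t \<in> {p k..p (Suc k)}\<rbrakk> \<Longrightarrow> f t = 2 powi (m k) * t + c k"
    by metis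
  have fp: "f (p k) \<in> dyadic_rationals" if "k \<le> 2 ^ N" for k
    using that
  proof (induction k)
    case 0
    then show ?case using f dyadic_of_int[of 0] by (simp add: p_def thompson_group_iff)
  next
    case (Suc k)
    have "f (p (Suc k)) = f (p k) + 2 powi (m k) * (1 / 2 ^ N)"
      using mc[of k "p k"] mc[of k "p (Suc k)"] Suc.prems p(2)[of k]
      by (simp add: p_def add_divide_distrib distrib_left)
    moreover have "2 powi (m k) * (1 / 2 ^ N) \<in> dyadic_rationals"
      using dyadic_of_int[of 1] by (intro dyadic_powi dyadic_divide) simp
    ultimately show ?case using Suc by (simp only: dyadic_add)
  qed
  have c: "c k \<in> dyadic_rationals" if "k < 2 ^ N" for k
  proof -
    have "c k = f (p k) - 2 powi (m k) * p k" using mc[of k "p k"] that p(2)[of k] by simp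
    then show ?thesis using fp[of k] that by (auto simp: p_def intro!: dyadic_intros)
  qed
  have "\<forall>\<^sub>F n in sequentially. \<forall>k\<in>{..<2 ^ N}. m k \<le> int n \<and> 2 ^ nat (int n - m k) * c k \<in> \<int>"
  proof (intro eventually_ball_finite ballI)
    fix k :: nat assume "k \<in> {..<2 ^ N}"
    then obtain l where l: "\<And>n. n \<ge> l \<Longrightarrow> 2 ^ n * c k \<in> \<int>"
      using c[of k] by (auto simp: dyadic_rationals_iff_eventually eventually_sequentially)
    show "\<forall>\<^sub>F n in sequentially. m k \<le> int n \<and> 2 ^ nat (int n - m k) * c k \<in> \<int>"
      unfolding eventually_sequentially by (rule exI[of _ "l + nat (m k)"]) (auto intro!: l)
  qed simp
  then obtain n0 where
    n0: "\<And>n k. \<lbrakk>n \<ge> n0; k < 2 ^ N\<rbrakk> \<Longrightarrow> m k \<le> int n \<and> 2 ^ nat (int n - m k) * c k \<in> \<int>"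
    by (auto simp: eventually_sequentially)
  define n where "n = max N n0"
  have "\<exists>a l. dyadic_piece f n i a l" if i: "i < 2 ^ n" for i
  proof -
    define q where "q = (2::nat) ^ (n - N)"
    have nN: "n = (n - N) + N" by (simp add: n_def)
    have q: "q > 0" "2 ^ n = q * 2 ^ N"
      unfolding q_def by simp (metis nN power_add)
    have "real (2 ^ n) = real (q * 2 ^ N)" by (simp only: q(2))
    then have real_q: "real q * 2 ^ N = 2 ^ n" by simp
    define k where "k = i div q"
    have k: "k < 2 ^ N"
      using i q unfolding k_def by (simp add: less_mult_imp_div_less mult.commute)
    have p_q: "p j = real (j * q) / 2 ^ n" for j
      using q(1) by (simp add: p_def flip: real_q)
    have "k * q \<le> i" "i < (k + 1) * q"
      using q(1) by (simp_all add: k_def dividend_less_times_div mult.commute)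
    then have "real (k * q) \<le> real i" "real (i + 1) \<le> real ((k + 1) * q)"
      by (simp_all only: of_nat_le_iff)
    then have lo: "p k \<le> real i / 2 ^ n" and hi: "(real i + 1) / 2 ^ n \<le> p (Suc k)"
      unfolding p_q by (intro divide_right_mono; simp)+
    define l where "l = nat (int n - m k)"
    have l: "m k = int n - int l" and "2 ^ l * c k \<in> \<int>"
      using n0[of n k] k by (auto simp: l_def n_def)
    then obtain z where z: "2 ^ l * c k = of_int z" by (auto elim: Ints_cases)
    have "dyadic_piece f n i (int i + z) l"
      unfolding dyadic_piece_def
    proof
      fix t assume t: "t \<in> {real i / 2 ^ n..(real i + 1) / 2 ^ n}"
      then have "f t = 2 powi (m k) * t + c k" using lo hi by (intro mc k) auto
      also have "2 powi (m k) = (2 ^ n / 2 ^ l :: real)" by (simp add: l power_int_diff)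
      finally show "f t = (of_int (int i + z) + (2 ^ n * t - real i)) / 2 ^ l"
        by (simp add: field_simps flip: z)
    qed
    then show ?thesis by blast
  qed
  then show ?thesis by blast
qed

text \<open>
  Breakpoints of composites and inverses are images and preimages of breakpoints; this lemma keeps
  them dyadic.
\<close>

lemma thompson_group_dyadic_iff:
  assumes f: "f \<in> carrier thompson_group" and t: "t \<in> {0..1}"
  shows "f t \<in> dyadic_rationals \<longleftrightarrow> t \<in> dyadic_rationals"
proof -
  obtain n where n: "\<And>i. i < 2 ^ n \<Longrightarrow> \<exists>a l. dyadic_piece f n i a l"
    using thompson_group_dyadic_pieces[OF f] by blast
  obtain i where i: "i < 2 ^ n" "t \<in> {real i / 2 ^ n..(real i + 1) / 2 ^ n}"
    using dyadic_piece_cover[OF t] by blast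
  obtain a l where "dyadic_piece f n i a l" using n i(1) by blast
  then have ft: "f t = (of_int a + (2 ^ n * t - real i)) / 2 ^ l"
    using i(2) by (simp add: dyadic_piece_def)
  then have "t = (2 ^ l * f t - of_int a + real i) / 2 ^ n" by (simp add: field_simps)
  then show ?thesis using ft by (metis dyadic_intros)
qed

lemma compose_thompson_group:
  assumes f: "f \<in> carrier thompson_group" and g: "g \<in> carrier thompson_group"
  shows "compose {0..1} f g \<in> carrier thompson_group"
proof -
  obtain B where B: "finite B" "B \<subseteq> dyadic_rationals"
    "\<And>a b. \<lbrakk>0 \<le> a; a < b; b \<le> 1; {a<..<b} \<inter> B = {}\<rbrakk> \<Longrightarrow>
      \<exists>m c. \<forall>t\<in>{a..b}. f t = 2 powi m * t + c"
    using that by (rule thompson_group_affine_piece[OF f])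
  obtain C where C: "finite C" "C \<subseteq> dyadic_rationals"
    "\<And>a b. \<lbrakk>0 \<le> a; a < b; b \<le> 1; {a<..<b} \<inter> C = {}\<rbrakk> \<Longrightarrow>
      \<exists>m c. \<forall>t\<in>{a..b}. g t = 2 powi m * t + c"
    using that by (rule thompson_group_affine_piece[OF g])
  define D where "D = C \<union> (g -` B \<inter> {0..1})"
  have g01: "g t \<in> {0..1}" if "t \<in> {0..1}" for t using thompson_group_in_unit[OF g that] .
  have "inj_on g {0..1}" using thompson_group_Bij[OF g] by (auto simp: Bij_def bij_betw_def)
  then have "finite D" using B(1) C(1) by (simp add: D_def finite_vimage_IntI)
  moreover have "D \<subseteq> dyadic_rationals"
    using B(2) C(2) thompson_group_dyadic_iff[OF g] by (auto simp: D_def)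
  moreover have "\<exists>m c. \<forall>t\<in>{a<..<b}. compose {0..1} f g t = 2 powi m * t + c"
    if ab: "0 \<le> a" "a < b" "b \<le> 1" "{a<..<b} \<inter> D = {}" for a b
  proof -
    obtain m c where mc: "\<forall>t\<in>{a..b}. g t = 2 powi m * t + c"
      using C(3)[of a b] ab by (auto simp: D_def)
    have "{g a<..<g b} \<inter> B = {}"
    proof -
      have False if "y \<in> B" "g a < y" "y < g b" for y
      proof -
        have "y \<in> {0..1}" using that g01[of a] g01[of b] ab by auto
        then obtain t where t: "t \<in> {0..1}" "g t = y" by (rule thompson_group_surj[OF g])
        then have "a < t" "t < b"
          using that ab thompson_group_less_iff[OF g, of a t] thompson_group_less_iff[OF g, of t b] by auto
        then have "t \<in> {a<..<b} \<inter> D" using t that by (auto simp: D_def)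
        then show False using ab by blast
      qed
      then show ?thesis by auto
    qed
    then obtain m' c' where mc': "\<forall>t\<in>{g a..g b}. f t = 2 powi m' * t + c'"
      using B(3)[of "g a" "g b"] g01[of a] g01[of b] thompson_group_less_iff[OF g, of a b] ab by auto
    have "compose {0..1} f g t = 2 powi (m' + m) * t + (2 powi m' * c + c')" if "t \<in> {a<..<b}" for t
    proof -
      have "g t \<in> {g a..g b}"
        using that ab thompson_group_less_iff[OF g, of a t] thompson_group_less_iff[OF g, of t b] by auto
      then show ?thesis
        using that ab mc mc' by (simp add: compose_def power_int_add distrib_left)
    qed
    then show ?thesis by (intro exI ballI)
  qed
  ultimately have "dyadic_piecewise_linear (compose {0..1} f g)"
    by (rule dyadic_piecewise_linearI)
  moreover have "continuous_on {0..1} (\<lambda>t. f (g t))"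
  proof (rule continuous_on_compose2[where t = "{0..1}" and g = f and f = g])
    show "continuous_on {0..1} f" "continuous_on {0..1} g"
      using f g by (simp_all add: thompson_group_iff)
    show "g ` {0..1} \<subseteq> {0..1}" using g01 by blast
  qed
  then have "continuous_on {0..1} (compose {0..1} f g)"
    by (rule continuous_on_eq) (simp add: compose_def)
  moreover have "strict_mono_on {0..1} (compose {0..1} f g)"
    using thompson_group_less_iff[OF f] thompson_group_less_iff[OF g] g01
    by (intro strict_mono_onI) (simp add: compose_def)
  moreover have "compose {0..1} f g 0 = 0" "compose {0..1} f g 1 = 1"
    using f g by (simp_all add: thompson_group_iff compose_def)
  ultimately show ?thesis by (simp add: thompson_group_iff)
qed

lemma inverse_thompson_group:
  assumes f: "f \<in> carrier thompson_group"
  shows "(\<lambda>t\<in>{0..1}. inv_into {0..1} f t) \<in> carrier thompson_group"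
proof -
  define g where "g = (\<lambda>t\<in>{0..1}. inv_into {0..1} f t)"
  have bij: "bij_betw f {0..1} {0..1}" using thompson_group_Bij[OF f] by (simp add: Bij_def)
  have g01: "g t \<in> {0..1}" and fg: "f (g t) = t" if "t \<in> {0..1}" for t
    using that bij bij_betw_inv_into_right[OF bij that] inv_into_into[of t f "{0..1}"]
    by (auto simp: bij_betw_def g_def)
  have less: "g s < g t \<longleftrightarrow> s < t" if "s \<in> {0..1}" "t \<in> {0..1}" for s t
    using thompson_group_less_iff[OF f g01[OF that(1)] g01[OF that(2)]] that by (simp only: fg)
  have gf: "g t = s" if "s \<in> {0..1}" "f s = t" for s t
    using that bij thompson_group_in_unit[OF f, of s] by (auto simp: bij_betw_inv_into_left g_def)
  obtain B where B: "finite B" "B \<subseteq> dyadic_rationals"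
    "\<And>a b. \<lbrakk>0 \<le> a; a < b; b \<le> 1; {a<..<b} \<inter> B = {}\<rbrakk> \<Longrightarrow>
      \<exists>m c. \<forall>t\<in>{a..b}. f t = 2 powi m * t + c"
    using that by (rule thompson_group_affine_piece[OF f])
  have "finite (f ` (B \<inter> {0..1}))" using B(1) by simp
  moreover have "f ` (B \<inter> {0..1}) \<subseteq> dyadic_rationals"
    using B(2) thompson_group_dyadic_iff[OF f] by auto
  moreover have "\<exists>m c. \<forall>t\<in>{a<..<b}. g t = 2 powi m * t + c"
    if ab: "0 \<le> a" "a < b" "b \<le> 1" "{a<..<b} \<inter> f ` (B \<inter> {0..1}) = {}" for a b
  proof -
    have "{g a<..<g b} \<inter> B = {}"
    proof -
      have False if y: "y \<in> B" "g a < y" "y < g b" for y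
      proof -
        have y01: "y \<in> {0..1}" using y(2,3) g01[of a] g01[of b] ab(1-3) by auto
        have "f (g a) < f y" "f y < f (g b)"
          using thompson_group_less_iff[OF f] y(2,3) y01 g01[of a] g01[of b] ab(1-3) by auto
        then have "f y \<in> {a<..<b}" using fg[of a] fg[of b] ab(1-3) by auto
        then show False using ab(4) y(1) y01 by blast
      qed
      then show ?thesis by auto
    qed
    then obtain m c where mc: "\<forall>t\<in>{g a..g b}. f t = 2 powi m * t + c"
      using B(3)[of "g a" "g b"] g01[of a] g01[of b] less[of a b] ab(1-3)
      by auto
    have "g t = 2 powi (- m) * t + - (2 powi (- m) * c)" if t: "t \<in> {a<..<b}" for t
    proof -
      have "g t \<in> {g a..g b}"
        using t ab(1-3) less[of a t] less[of t b] by auto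
      then have "f (g t) = 2 powi m * g t + c" using mc by blast
      then have "t = 2 powi m * g t + c" using fg[of t] t ab(1-3) by simp
      then have "t - c = 2 powi m * g t" by linarith
      then have "2 powi (- m) * (t - c) = g t"
        by (simp add: power_int_minus)
      then show ?thesis unfolding right_diff_distrib by linarith
    qed
    then show ?thesis by (intro exI ballI)
  qed
  ultimately have "dyadic_piecewise_linear g"
    by (rule dyadic_piecewise_linearI)
  moreover have "continuous_on {0..1} g"
  proof -
    obtain h where h: "homeomorphism {0..1} {0..1} f h" using f by (auto simp: thompson_group_def)
    then have "continuous_on {0..1} h" by (simp add: homeomorphism_def)
    then show ?thesis
    proof (rule continuous_on_eq)
      fix t :: real assume "t \<in> {0..1}"
      then show "h t = g t"
        using h by (metis gf homeomorphism_def imageI)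
    qed
  qed
  moreover have "strict_mono_on {0..1} g" using less by (intro strict_mono_onI) blast
  moreover have "g 0 = 0" "g 1 = 1" using f gf[of 0] gf[of 1] by (auto simp: thompson_group_iff)
  ultimately show ?thesis by (simp add: thompson_group_iff g_def)
qed

lemma id_thompson_group: "(\<lambda>t\<in>{0..1}. t) \<in> carrier thompson_group"
proof -
  have "\<exists>(m::int) (c::real). \<forall>t\<in>{a<..<b}. (\<lambda>t\<in>{0..1}. t) t = 2 powi m * t + c"
    if "0 \<le> a" "a < b" "b \<le> 1" for a b
    by (rule exI[of _ 0], rule exI[of _ 0]) (use that in auto)
  then have "dyadic_piecewise_linear (\<lambda>t\<in>{0..1}. t)"
    unfolding dyadic_piecewise_linear_def by (intro exI[of _ "{}"]) auto
  moreover have "continuous_on {0..1} (\<lambda>t\<in>{0..1}. t::real)"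
    by (rule continuous_on_eq[of _ "\<lambda>t. t"]) auto
  ultimately show ?thesis by (auto simp: thompson_group_iff intro!: strict_mono_onI)
qed

lemma BijGroup_mult: "f \<in> Bij S \<Longrightarrow> g \<in> Bij S \<Longrightarrow> f \<otimes>\<^bsub>BijGroup S\<^esub> g = compose S f g"
  by (simp add: BijGroup_def)

lemma subgroup_thompson_group: "subgroup (carrier thompson_group) (BijGroup {0..1})"
proof (rule group.subgroupI[OF group_BijGroup])
  show "carrier thompson_group \<subseteq> carrier (BijGroup {0..1})"
    using thompson_group_Bij by (auto simp: BijGroup_def)
  show "carrier thompson_group \<noteq> {}" using id_thompson_group by blast
  fix f assume f: "f \<in> carrier thompson_group"
  then show "inv\<^bsub>BijGroup {0..1}\<^esub> f \<in> carrier thompson_group"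
    by (simp only: inv_BijGroup thompson_group_Bij inverse_thompson_group)
  fix g assume g: "g \<in> carrier thompson_group"
  show "f \<otimes>\<^bsub>BijGroup {0..1}\<^esub> g \<in> carrier thompson_group"
    by (simp only: BijGroup_mult thompson_group_Bij compose_thompson_group f g)
qed

lemma group_thompson_group: "group thompson_group"
proof -
  have "thompson_group = BijGroup {0..1}\<lparr>carrier := carrier thompson_group\<rparr>"
    unfolding thompson_group_def
    by (cases "BijGroup {0..1::real}") (simp only: partial_object.simps)
  then show ?thesis
    by (metis group.subgroup_imp_group group_BijGroup subgroup_thompson_group)
qed

lemma thompson_group_mult:
  assumes "f \<in> carrier thompson_group" "g \<in> carrier thompson_group" "t \<in> {0..1}"
  shows "(f \<otimes>\<^bsub>thompson_group\<^esub> g) t = f (g t)"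
proof -
  have "f \<otimes>\<^bsub>thompson_group\<^esub> g = compose {0..1} f g"
    using BijGroup_mult[OF assms(1,2)[THEN thompson_group_Bij]] by (simp add: thompson_group_def)
  then show ?thesis using assms(3) by (simp add: compose_def)
qed

lemma thompson_group_one: "t \<in> {0..1} \<Longrightarrow> \<one>\<^bsub>thompson_group\<^esub> t = t"
  by (simp add: thompson_group_def BijGroup_def)

section \<open>The generators of Thompson's group\<close>

text \<open>
  The points \<open>0, 1/2, 3/4, 7/8, \<dots>\<close> cut the interval into the leaves of the infinite right spine
  of the binary tree: the interval number \<open>i\<close> goes from \<open>spine i\<close> to \<open>spine (Suc i)\<close> and has
  length \<open>2\<^sup>-\<^sup>i\<^sup>-\<^sup>1\<close>.
\<close>

definition spine :: "nat \<Rightarrow> real" where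
  "spine i = 1 - 1 / 2 ^ i"

lemma spine_0: "spine 0 = 0"
  by (simp add: spine_def)

lemma spine_Suc: "spine (Suc i) = (spine i + 1) / 2"
  by (simp add: spine_def field_simps)

lemma spine_nonneg: "0 \<le> spine i" and spine_less_1: "spine i < 1"
  by (simp_all add: spine_def)

lemma spine_mono: "i \<le> j \<Longrightarrow> spine i \<le> spine j"
  by (simp add: spine_def frac_le)

lemma spine_less_Suc: "spine i < spine (Suc i)"
  using spine_less_1[of i] by (simp add: spine_Suc)

lemma spine_width: "2 ^ Suc i * (t - spine i) = 2 ^ Suc i * (t - spine (Suc i)) + 1"
  by (simp add: spine_def field_simps)

lemma spine_dyadic: "spine i \<in> dyadic_rationals"
  unfolding spine_def using dyadic_of_int[of 1] by (intro dyadic_diff dyadic_divide) auto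

text \<open>
  The usual generator \<open>x\<^sub>i\<close>: it fixes the points up to \<open>spine i\<close> and has slopes \<open>2\<close>, \<open>1\<close>, \<open>1/2\<close> after
  that, so that it carries \<open>[spine k, 1]\<close> onto \<open>[spine (Suc k), 1]\<close> for \<open>k > i\<close>. Being concave
  on \<open>[spine i, 1]\<close>, it is a minimum of affine maps there, and to the left that minimum is at most
  \<open>t\<close>. This formula makes continuity and monotonicity evident.
\<close>

definition thompson_gen :: "nat \<Rightarrow> real \<Rightarrow> real" where
  "thompson_gen i = (\<lambda>t\<in>{0..1}.
    max t (min (2 * t - spine i) (min (t + (1 - spine i) / 4) ((t + 1) / 2))))"

lemma thompson_gen_eqs:
  assumes "t \<in> {0..1}"
  shows "t \<le> spine i \<Longrightarrow> thompson_gen i t = t"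
    and "spine i \<le> t \<Longrightarrow> t \<le> spine i + (1 - spine i) / 4 \<Longrightarrow> thompson_gen i t = 2 * t - spine i"
    and "spine i + (1 - spine i) / 4 \<le> t \<Longrightarrow> t \<le> spine (Suc i) \<Longrightarrow>
      thompson_gen i t = t + (1 - spine i) / 4"
    and "spine (Suc i) \<le> t \<Longrightarrow> thompson_gen i t = (t + 1) / 2"
  using assms spine_less_1[of i]
  by (auto simp: thompson_gen_def spine_Suc max_def min_def add_divide_distrib diff_divide_distrib)

lemma thompson_gen_ge: "t \<in> {0..1} \<Longrightarrow> t \<le> thompson_gen i t"
  by (simp add: thompson_gen_def)

lemma thompson_gen_greater:
  assumes "spine i < t" "t < 1"
  shows "t < thompson_gen i t"
  using assms spine_nonneg[of i] by (simp add: thompson_gen_def less_max_iff_disj)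

text \<open>
  The generators are copies of each other under the map \<open>t \<mapsto> (t + 1) / 2\<close>. As \<open>x\<^sub>j\<close> coincides with
  that map on \<open>[spine (Suc j), 1]\<close>, this is the relation \<open>x\<^sub>j x\<^sub>k = x\<^sub>k\<^sub>+\<^sub>1 x\<^sub>j\<close> on the part of the
  interval where \<open>x\<^sub>k\<close> moves points.
\<close>

lemma thompson_gen_rescale:
  "t \<in> {0..1} \<Longrightarrow> thompson_gen (Suc i) ((t + 1) / 2) = (thompson_gen i t + 1) / 2"
  by (simp add: thompson_gen_def spine_Suc max_def min_def field_simps)

lemma thompson_gen_closed: "thompson_gen i \<in> carrier thompson_group"
proof -
  let ?f = "\<lambda>t. max t (min (2 * t - spine i) (min (t + (1 - spine i) / 4) ((t + 1) / 2)))"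
  have "continuous_on {0..1} ?f" by (intro continuous_intros) simp_all
  then have "continuous_on {0..1} (thompson_gen i)"
    by (rule continuous_on_eq) (simp add: thompson_gen_def)
  moreover have "?f s < ?f t" if "s < t" for s t
    using that by (auto simp: max_def min_def add_divide_distrib diff_divide_distrib)
  then have "strict_mono_on {0..1} (thompson_gen i)"
    by (intro strict_mono_onI) (simp add: thompson_gen_def)
  moreover have "dyadic_piecewise_linear (thompson_gen i)"
  proof (rule dyadic_piecewise_linearI)
    let ?m = "spine i + (1 - spine i) / 4"
    let ?B = "{spine i, ?m, spine (Suc i)}"
    show "finite ?B" by simp
    have "(1 - spine i) / 2 ^ 2 \<in> dyadic_rationals"
      using dyadic_of_int[of 1] spine_dyadic by (intro dyadic_divide dyadic_diff) auto
    then have "?m \<in> dyadic_rationals" using spine_dyadic by (intro dyadic_add) auto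
    then show "?B \<subseteq> dyadic_rationals" using spine_dyadic by simp
    fix a b :: real assume ab: "0 \<le> a" "a < b" "b \<le> 1" "{a<..<b} \<inter> ?B = {}"
    then have nm: "\<And>p. p \<in> ?B \<Longrightarrow> p \<le> a \<or> b \<le> p" by (metis disjoint_iff greaterThanLessThan_iff not_le)
    consider "b \<le> spine i" | "spine i \<le> a" "b \<le> ?m" | "?m \<le> a" "b \<le> spine (Suc i)" | "spine (Suc i) \<le> a"
      using nm[of "spine i"] nm[of ?m] nm[of "spine (Suc i)"] by auto
    then show "\<exists>(m :: int) (c :: real). \<forall>t\<in>{a<..<b}. thompson_gen i t = 2 powi m * t + c"
    proof cases
      case 1
      show ?thesis by (rule exI[of _ 0], rule exI[of _ 0]) (use 1 ab in \<open>auto simp: thompson_gen_eqs(1)\<close>)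
    next
      case 2
      show ?thesis by (rule exI[of _ 1], rule exI[of _ "- spine i"]) (use 2 ab in \<open>auto simp: thompson_gen_eqs(2)\<close>)
    next
      case 3
      show ?thesis by (rule exI[of _ 0], rule exI[of _ "(1 - spine i) / 4"]) (use 3 ab in \<open>auto simp: thompson_gen_eqs(3)\<close>)
    next
      case 4
      show ?thesis by (rule exI[of _ "-1"], rule exI[of _ "1 / 2"])
          (use 4 ab in \<open>auto simp: thompson_gen_eqs(4) power_int_minus field_simps\<close>)
    qed
  qed
  moreover have "thompson_gen i 0 = 0" "thompson_gen i 1 = 1"
    using spine_nonneg[of i] spine_less_1[of "Suc i"] by (simp_all add: thompson_gen_eqs)
  moreover have "thompson_gen i \<in> extensional {0..1}" by (simp add: thompson_gen_def)
  ultimately show ?thesis by (simp add: thompson_group_iff)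
qed

lemma thompson_gen_relation:
  assumes "j < k"
  shows "thompson_gen j \<otimes>\<^bsub>thompson_group\<^esub> thompson_gen k =
    thompson_gen (Suc k) \<otimes>\<^bsub>thompson_group\<^esub> thompson_gen j"
proof -
  interpret group thompson_group by (rule group_thompson_group)
  show ?thesis
  proof (rule thompson_group_eqI)
    fix t :: real assume t: "t \<in> {0..1}"
    have jk: "spine (Suc j) \<le> spine k" using assms by (intro spine_mono) simp
    have in01: "thompson_gen i t \<in> {0..1}" for i
      using thompson_group_in_unit[OF thompson_gen_closed t] .
    have "thompson_gen j (thompson_gen k t) = thompson_gen (Suc k) (thompson_gen j t)"
    proof (cases "t \<le> spine k")
      case True
      have "spine k \<in> {0..1}" using spine_nonneg[of k] spine_less_1[of k] by simp
      then have "thompson_gen j t \<le> thompson_gen j (spine k)"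
        using True thompson_group_less_iff[OF thompson_gen_closed[of j], of "spine k" t] t by auto
      also have "\<dots> = spine (Suc k)"
        using jk \<open>spine k \<in> {0..1}\<close> by (simp add: thompson_gen_eqs(4) spine_Suc[of k])
      finally show ?thesis using True t in01[of j] by (simp add: thompson_gen_eqs(1))
    next
      case False
      then have "spine (Suc j) \<le> t" "spine (Suc j) \<le> thompson_gen k t"
        using jk thompson_gen_ge[OF t, of k] by auto
      then show ?thesis using t in01[of k]
        by (simp add: thompson_gen_eqs(4) thompson_gen_rescale)
    qed
    then show "(thompson_gen j \<otimes>\<^bsub>thompson_group\<^esub> thompson_gen k) t =
      (thompson_gen (Suc k) \<otimes>\<^bsub>thompson_group\<^esub> thompson_gen j) t"
      using t by (simp add: thompson_group_mult thompson_gen_closed)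
  qed (simp_all add: thompson_gen_closed)
qed

lemma thompson_relations_gen: "thompson_relations thompson_group thompson_gen"
  by (intro thompson_relations.intro thompson_relations_axioms.intro group_thompson_group
      thompson_gen_closed thompson_gen_relation)

interpretation F: thompson_relations thompson_group thompson_gen
  by (rule thompson_relations_gen)

lemma pos_word_Cons:
  "t \<in> {0..1} \<Longrightarrow> F.pos (k # u) t = thompson_gen k (F.pos u t)"
  by (simp add: thompson_group_mult F.closed)

lemma pos_word_in_unit: "t \<in> {0..1} \<Longrightarrow> F.pos u t \<in> {0..1}"
  by (rule thompson_group_in_unit[OF F.word_closed])

lemma pos_word_fixes:
  assumes t: "t \<in> {0..1}"
  shows "\<forall>k\<in>set v. t \<le> spine k \<Longrightarrow> F.pos v t = t"
proof (induction v)
  case Nil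
  then show ?case using t by (simp add: thompson_group_one)
next
  case (Cons k v)
  then show ?case using t by (simp only: pos_word_Cons) (simp add: thompson_gen_eqs(1))
qed

lemma pos_word_ge:
  assumes t: "t \<in> {0..1}"
  shows "t \<le> F.pos u t"
proof (induction u)
  case Nil
  then show ?case using t by (simp add: thompson_group_one)
next
  case (Cons k u)
  then show ?case
    using thompson_gen_ge[OF pos_word_in_unit[OF t], of u k] by (simp only: pos_word_Cons t)
qed

lemma pos_word_moves:
  assumes t: "spine i < t" "t < 1"
  shows "i \<in> set u \<Longrightarrow> t < F.pos u t"
proof (induction u)
  case (Cons k u)
  have t01: "t \<in> {0..1}" using t spine_nonneg[of i] by simp
  have u1: "F.pos u t < 1"
    using thompson_group_less_iff[OF F.word_closed, of t 1] F.word_closed t01 t(2)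
    by (simp add: thompson_group_iff)
  have ge: "t \<le> F.pos u t" by (rule pos_word_ge[OF t01])
  show ?case
  proof (cases "i \<in> set u")
    case True
    then show ?thesis
      using Cons.IH[OF True] thompson_gen_ge[OF pos_word_in_unit[OF t01], of u k]
      by (simp only: pos_word_Cons t01)
  next
    case False
    then have "k = i" using Cons.prems by simp
    moreover have "F.pos u t < thompson_gen i (F.pos u t)"
      using t(1) ge u1 by (intro thompson_gen_greater) auto
    ultimately show ?thesis using ge by (simp only: pos_word_Cons t01)
  qed
qed simp

text \<open>
  A positive word without letters up to \<open>i\<close> fixes the point \<open>spine (Suc i)\<close>. A positive word that
  contains \<open>i\<close> moves it: no generator moves a point to the left, and \<open>x\<^sub>i\<close> moves all points strictly
  between \<open>spine i\<close> and \<open>1\<close> to the right.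
\<close>

lemma pos_word_separated:
  assumes "i \<in> set u" "\<forall>k\<in>set v. i < k"
  shows "F.pos u \<noteq> F.pos v"
proof -
  have "spine (Suc i) < F.pos u (spine (Suc i))"
    by (rule pos_word_moves[OF spine_less_Suc spine_less_1 assms(1)])
  moreover have "F.pos v (spine (Suc i)) = spine (Suc i)"
    using assms(2) spine_nonneg[of "Suc i"] spine_less_1[of "Suc i"]
    by (intro pos_word_fixes) (auto intro!: spine_mono Suc_leI)
  ultimately show ?thesis by auto
qed

section \<open>Forest diagrams and surjectivity\<close>

text \<open>
  The map \<open>f\<close> carries the spine interval number \<open>i\<close> affinely onto the standard dyadic interval
  \<open>[a / 2\<^sup>l, (a + 1) / 2\<^sup>l]\<close>, where \<open>p = (a, l)\<close>.
\<close>

definition leaf :: "(real \<Rightarrow> real) \<Rightarrow> nat \<Rightarrow> int \<times> nat \<Rightarrow> bool" where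
  "leaf f i p \<longleftrightarrow> (\<forall>t\<in>{spine i..spine (Suc i)}.
    f t = (of_int (fst p) + 2 ^ Suc i * (t - spine i)) / 2 ^ snd p)"

text \<open>
  An algebraic form of a tree diagram whose domain tree is a right spine: the first spine intervals
  go to the standard dyadic intervals listed in \<open>L\<close>, and the rest of the interval goes affinely onto
  \<open>[1 - 2\<^sup>-\<^sup>e, 1]\<close>.
\<close>

definition forest :: "(real \<Rightarrow> real) \<Rightarrow> (int \<times> nat) list \<Rightarrow> nat \<Rightarrow> bool" where
  "forest f L e \<longleftrightarrow> (\<forall>i<length L. leaf f i (L ! i)) \<and>
    (\<forall>t\<in>{spine (length L)..1}. f t = 1 - 2 ^ length L * (1 - t) / 2 ^ e)"

lemma leafD: "leaf f i (a, l) \<Longrightarrow> spine i \<le> t \<Longrightarrow> t \<le> spine (Suc i) \<Longrightarrow>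
    f t = (of_int a + 2 ^ Suc i * (t - spine i)) / 2 ^ l"
  by (simp add: leaf_def)

lemma spine_cover:
  "t \<in> {0..1} \<Longrightarrow> (\<exists>i<n. t \<in> {spine i..spine (Suc i)}) \<or> t \<in> {spine n..1}"
proof (induction n)
  case (Suc n)
  then show ?case by (auto simp: less_Suc_eq)
qed (simp add: spine_0)

lemma forest_determines:
  assumes "forest f L e" "forest g L e" "t \<in> {0..1}"
  shows "f t = g t"
  using spine_cover[OF assms(3), of "length L"] assms(1,2) by (auto simp: forest_def leaf_def)

text \<open>
  The last interval of the diagram may be halved at no cost, since halving the domain interval
  only lengthens the spine.
\<close>

lemma forest_extend:
  assumes "forest f L e"
  shows "forest f (L @ [(2 ^ Suc e - 2, Suc e)]) (Suc e)"
proof -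
  let ?N = "length L"
  have tail: "f t = 1 - 2 ^ ?N * (1 - t) / 2 ^ e" if "t \<in> {spine ?N..1}" for t
    using assms that by (simp add: forest_def)
  have "leaf f ?N (2 ^ Suc e - 2, Suc e)"
    unfolding leaf_def
  proof
    fix t assume t: "t \<in> {spine ?N..spine (Suc ?N)}"
    have *: "2 ^ Suc ?N * (t - spine ?N) = 2 - 2 ^ Suc ?N * (1 - t)"
      by (simp add: spine_def field_simps)
    have "f t = 1 - 2 ^ ?N * (1 - t) / 2 ^ e"
      using t spine_less_1[of "Suc ?N"] by (intro tail) simp
    then show "f t = (of_int (fst (2 ^ Suc e - 2, Suc e)) + 2 ^ Suc ?N * (t - spine ?N)) / 2 ^ snd (2 ^ Suc e - 2, Suc e)"
      by (simp only: fst_conv snd_conv *) (simp add: field_simps)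
  qed
  moreover have "f t = 1 - 2 ^ Suc ?N * (1 - t) / 2 ^ Suc e" if "t \<in> {spine (Suc ?N)..1}" for t
    using tail[of t] that spine_less_Suc[of ?N] by simp
  ultimately show ?thesis using assms by (auto simp: forest_def nth_append less_Suc_eq)
qed

text \<open>
  Any other leaf can be halved at the cost of a generator. The inverse of \<open>x\<^sub>i\<close> maps the spine intervals
  \<open>i\<close> and \<open>i + 1\<close> affinely onto the two halves of the spine interval \<open>i\<close>, fixes everything before
  them, and shifts each later spine interval to its predecessor.
\<close>

lemma forest_split:
  assumes f: "f \<in> carrier thompson_group" and forest: "forest f (L1 @ (a, l) # L2) e"
  shows "forest (f \<otimes>\<^bsub>thompson_group\<^esub> inv\<^bsub>thompson_group\<^esub> (thompson_gen (length L1)))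
    (L1 @ (2 * a, Suc l) # (2 * a + 1, Suc l) # L2) e"
proof -
  define i where "i = length L1"
  define N where "N = length L1 + Suc (length L2)"
  define g where "g = f \<otimes>\<^bsub>thompson_group\<^esub> inv\<^bsub>thompson_group\<^esub> (thompson_gen i)"
  have gc: "g \<in> carrier thompson_group" by (simp add: g_def f thompson_gen_closed)
  have "g \<otimes>\<^bsub>thompson_group\<^esub> thompson_gen i = f"
    by (simp add: g_def f thompson_gen_closed F.m_assoc)
  then have g_gen: "g t = f r" if "r \<in> {0..1}" "thompson_gen i r = t" for t r
    using thompson_group_mult[OF gc thompson_gen_closed[of i] that(1)] that(2) by simp
  have s: "0 \<le> spine i" "spine i < 1" by (simp_all add: spine_nonneg spine_less_1)
  have g1: "g t = f t" if "0 \<le> t" "t \<le> spine i" for t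
    using that s by (intro g_gen thompson_gen_eqs(1)) auto
  have g2: "g t = f ((t + spine i) / 2)" if t: "spine i \<le> t" "t \<le> spine (Suc i)" for t
  proof (rule g_gen)
    show "(t + spine i) / 2 \<in> {0..1}" using t s by (simp add: spine_Suc)
    then show "thompson_gen i ((t + spine i) / 2) = t"
      using t by (subst thompson_gen_eqs(2)) (simp_all add: spine_Suc add_divide_distrib diff_divide_distrib)
  qed
  have g3: "g t = f (t - (1 - spine i) / 4)" if t: "spine (Suc i) \<le> t" "t \<le> spine (Suc (Suc i))" for t
  proof (rule g_gen)
    show "t - (1 - spine i) / 4 \<in> {0..1}" using t s by (simp add: spine_Suc add_divide_distrib diff_divide_distrib)
    then show "thompson_gen i (t - (1 - spine i) / 4) = t"
      using t by (subst thompson_gen_eqs(3)) (simp_all add: spine_Suc add_divide_distrib diff_divide_distrib)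
  qed
  have g4: "g t = f (2 * t - 1)" if t: "spine (Suc (Suc i)) \<le> t" "t \<le> 1" for t
  proof (rule g_gen)
    show "2 * t - 1 \<in> {0..1}" using t s by (simp add: spine_Suc add_divide_distrib diff_divide_distrib)
    then show "thompson_gen i (2 * t - 1) = t"
      using t by (subst thompson_gen_eqs(4)) (simp_all add: spine_Suc add_divide_distrib diff_divide_distrib)
  qed
  have leaf_f: "leaf f j ((L1 @ (a, l) # L2) ! j)" if "j < N" for j
    using forest that by (simp add: forest_def N_def)
  have tail_f: "f t = 1 - 2 ^ N * (1 - t) / 2 ^ e" if "t \<in> {spine N..1}" for t
    using forest that by (simp add: forest_def N_def)
  have leaf_i: "leaf f i (a, l)" using leaf_f[of i] by (simp add: i_def N_def)
  have less: "leaf g j (L1 ! j)" if "j < i" for j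
  proof -
    have "leaf f j (L1 ! j)" using leaf_f[of j] that by (simp add: N_def i_def nth_append)
    moreover have "spine (Suc j) \<le> spine i" using that by (intro spine_mono) simp
    ultimately show ?thesis using spine_nonneg[of j] g1 by (simp add: leaf_def)
  qed
  have left: "leaf g i (2 * a, Suc l)"
    unfolding leaf_def
  proof
    fix t assume t: "t \<in> {spine i..spine (Suc i)}"
    then have "g t = f ((t + spine i) / 2)" by (intro g2) auto
    also have "\<dots> = (of_int a + 2 ^ Suc i * ((t + spine i) / 2 - spine i)) / 2 ^ l"
      using t by (intro leafD[OF leaf_i]) auto
    finally show "g t = (of_int (fst (2 * a, Suc l)) + 2 ^ Suc i * (t - spine i)) / 2 ^ snd (2 * a, Suc l)"
      by (simp add: field_simps)
  qed
  have right: "leaf g (Suc i) (2 * a + 1, Suc l)"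
    unfolding leaf_def
  proof
    fix t assume t: "t \<in> {spine (Suc i)..spine (Suc (Suc i))}"
    then have "g t = f (t - (1 - spine i) / 4)" by (intro g3) auto
    also have "\<dots> = (of_int a + 2 ^ Suc i * (t - (1 - spine i) / 4 - spine i)) / 2 ^ l"
      using t s by (intro leafD[OF leaf_i]) (auto simp: spine_Suc add_divide_distrib diff_divide_distrib)
    also have "2 ^ Suc i * (t - (1 - spine i) / 4 - spine i) = (1 + 2 ^ Suc (Suc i) * (t - spine (Suc i))) / 2"
      by (simp add: spine_def field_simps)
    finally show "g t = (of_int (fst (2 * a + 1, Suc l)) + 2 ^ Suc (Suc i) * (t - spine (Suc i))) /
        2 ^ snd (2 * a + 1, Suc l)"
      by (simp add: add_divide_distrib)
  qed
  have greater: "leaf g (Suc j) ((L1 @ (a, l) # L2) ! j)" if j: "i < j" "j < N" for j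
    unfolding leaf_def
  proof
    fix t assume t: "t \<in> {spine (Suc j)..spine (Suc (Suc j))}"
    then have arg: "2 * t - 1 \<in> {spine j..spine (Suc j)}" by (auto simp: spine_Suc add_divide_distrib)
    have "spine (Suc (Suc i)) \<le> spine (Suc j)" using j by (intro spine_mono) simp
    with t have "g t = f (2 * t - 1)" using spine_less_1[of "Suc (Suc j)"] by (intro g4) auto
    also have "\<dots> = (of_int (fst ((L1 @ (a, l) # L2) ! j)) + 2 ^ Suc j * (2 * t - 1 - spine j)) /
        2 ^ snd ((L1 @ (a, l) # L2) ! j)"
      using leaf_f[OF j(2)] arg unfolding leaf_def by blast
    also have "2 ^ Suc j * (2 * t - 1 - spine j) = 2 ^ Suc (Suc j) * (t - spine (Suc j))"
      by (simp add: spine_Suc[of j] field_simps)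
    finally show "g t = (of_int (fst ((L1 @ (a, l) # L2) ! j)) + 2 ^ Suc (Suc j) * (t - spine (Suc j))) /
        2 ^ snd ((L1 @ (a, l) # L2) ! j)" .
  qed
  have tail: "g t = 1 - 2 ^ Suc N * (1 - t) / 2 ^ e" if t: "t \<in> {spine (Suc N)..1}" for t
  proof -
    have "spine (Suc (Suc i)) \<le> spine (Suc N)" by (intro spine_mono) (simp add: N_def i_def)
    then have "g t = f (2 * t - 1)" using t by (intro g4) auto
    also have "\<dots> = 1 - 2 ^ N * (1 - (2 * t - 1)) / 2 ^ e"
      using t by (intro tail_f) (auto simp: spine_Suc)
    finally show ?thesis by (simp add: field_simps)
  qed
  let ?L = "L1 @ (2 * a, Suc l) # (2 * a + 1, Suc l) # L2"
  have "leaf g j (?L ! j)" if "j < Suc N" for j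
  proof -
    consider "j < i" | "j = i" | "j = Suc i" | "Suc i < j" by linarith
    then show ?thesis
    proof cases
      case 1
      then show ?thesis using less by (simp add: nth_append i_def)
    next
      case 2
      then show ?thesis using left by (simp add: nth_append i_def)
    next
      case 3
      then show ?thesis using right by (simp add: nth_append i_def)
    next
      case 4
      then obtain j' where "j = Suc j'" "i < j'" by (cases j) auto
      then show ?thesis using greater[of j'] that by (simp add: nth_append nth_Cons' i_def)
    qed
  qed
  then show ?thesis using tail by (simp add: forest_def N_def g_def i_def)
qed

text \<open>
  The leaves of the complete binary tree of depth \<open>n\<close>, except for the last one, which is the
  image of the tail in a forest diagram.
\<close>

definition uniform_leaves :: "nat \<Rightarrow> (int \<times> nat) list" where
  "uniform_leaves n = map (\<lambda>i. (int i, n)) [0..<2 ^ n - 1]"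

text \<open>
  The intervals of a diagram follow each other without gaps, from \<open>0\<close> to \<open>1\<close>; so if they all have
  length \<open>2\<^sup>-\<^sup>n\<close>, they are the leaves of the complete tree.
\<close>

lemma forest_uniform:
  assumes f: "f \<in> carrier thompson_group" and forest: "forest f L n"
    and level: "\<forall>p\<in>set L. snd p = n"
  shows "L = uniform_leaves n"
proof -
  define a where "a i = fst (L ! i)" for i
  have L: "L ! i = (a i, n)" if "i < length L" for i
    using that level by (simp add: a_def prod_eq_iff)
  have leaf: "leaf f i (a i, n)" if "i < length L" for i
    using forest that by (simp add: forest_def flip: L)
  have start: "f (spine i) = of_int (a i) / 2 ^ n" if "i < length L" for i
    using leafD[OF leaf[OF that], of "spine i"] spine_less_Suc[of i] by simp
  have f_spine: "f (spine i) = real i / 2 ^ n" if "i \<le> length L" for i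
    using that
  proof (induction i)
    case 0
    then show ?case using f by (simp add: spine_0 thompson_group_iff)
  next
    case (Suc i)
    then have "f (spine (Suc i)) = (of_int (a i) + 1) / 2 ^ n"
      using leafD[OF leaf, of i "spine (Suc i)"] spine_less_Suc[of i] spine_width[of i "spine (Suc i)"] by simp
    then show ?case using Suc start[of i] by (simp add: add_divide_distrib)
  qed
  have a: "a i = int i" if "i < length L" for i
    using start[OF that] f_spine[of i] that by simp
  have "f (spine (length L)) = 1 - 2 ^ length L * (1 - spine (length L)) / 2 ^ n"
    using forest spine_less_1[of "length L"] by (simp add: forest_def)
  then have "real (length L) + 1 = 2 ^ n" using f_spine[of "length L"] by (simp add: spine_def field_simps)
  then have "real (length L + 1) = real (2 ^ n)" by simp
  then have "length L = 2 ^ n - 1" unfolding of_nat_eq_iff by simp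
  then show ?thesis
    by (intro nth_equalityI) (simp_all add: uniform_leaves_def L a)
qed

text \<open>
  Halving leaves of level less than \<open>n\<close> (the tail included) as long as there are any ends in the
  complete tree of depth \<open>n\<close>. The weights \<open>3\<^sup>n\<^sup>-\<^sup>l\<close> ensure termination: a leaf of
  level \<open>l\<close> is replaced by two leaves, each with a third of its weight.
\<close>

lemma forest_refine:
  assumes H: "subgroup H thompson_group" and gen: "\<And>i. thompson_gen i \<in> H"
    and f: "f \<in> carrier thompson_group" and forest: "forest f L e"
    and level: "\<forall>p\<in>set L. snd p \<le> n" "e \<le> n"
  shows "\<exists>h\<in>H. forest (f \<otimes>\<^bsub>thompson_group\<^esub> h) (uniform_leaves n) n"
  using f forest level
proof (induction "(\<Sum>p\<leftarrow>L. 3 ^ (n - snd p)) + (3::nat) ^ (n - e)" arbitrary: f L e rule: less_induct)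
  case less
  interpret H: subgroup H thompson_group by (rule H)
  consider "e < n" | p where "p \<in> set L" "snd p < n" | "e = n" "\<forall>p\<in>set L. snd p = n"
    using less.prems by force
  then show ?case
  proof cases
    case 1
    then have "(3::nat) ^ (n - e) = 3 * 3 ^ (n - Suc e)"
      by (metis Suc_diff_Suc power_Suc)
    then show ?thesis
      using less.hyps[of "L @ [(2 ^ Suc e - 2, Suc e)]" "Suc e" f] forest_extend[OF less.prems(2)] less.prems 1
      by auto
  next
    case 2
    obtain a l where p: "p = (a, l)" by (cases p)
    obtain L1 L2 where L: "L = L1 @ (a, l) # L2" using 2 p by (metis split_list)
    let ?x = "inv\<^bsub>thompson_group\<^esub> (thompson_gen (length L1))"
    have x: "?x \<in> H" "?x \<in> carrier thompson_group" using gen by (simp_all add: thompson_gen_closed)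
    have "(3::nat) ^ (n - l) = 3 * 3 ^ (n - Suc l)"
      using 2 p by (metis Suc_diff_Suc power_Suc snd_conv)
    then obtain h where h: "h \<in> H" "forest (f \<otimes>\<^bsub>thompson_group\<^esub> ?x \<otimes>\<^bsub>thompson_group\<^esub> h) (uniform_leaves n) n"
      using less.hyps[of "L1 @ (2 * a, Suc l) # (2 * a + 1, Suc l) # L2" e "f \<otimes>\<^bsub>thompson_group\<^esub> ?x"]
        forest_split[of f L1 a l L2 e] less.prems x 2 by (auto simp: L p)
    then show ?thesis using less.prems(1) x by (intro bexI[of _ "?x \<otimes>\<^bsub>thompson_group\<^esub> h"]) (simp_all add: F.m_assoc)
  next
    case 3
    then show ?thesis using forest_uniform[OF less.prems(1), of L n] less.prems
      by (intro bexI[of _ "\<one>\<^bsub>thompson_group\<^esub>"]) auto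
  qed
qed

lemma forest_one: "forest \<one>\<^bsub>thompson_group\<^esub> [] 0"
  by (simp add: forest_def spine_0 thompson_group_one)

text \<open>
  A uniform diagram carries the spine intervals to the intervals \<open>[i / 2\<^sup>n, (i + 1) / 2\<^sup>n]\<close>. If \<open>f\<close>
  carries those to standard dyadic intervals, then the composite has a diagram, too.
\<close>

lemma forest_compose_uniform:
  assumes f: "f \<in> carrier thompson_group" and u: "u \<in> carrier thompson_group"
    and piece: "\<And>i. i < 2 ^ n \<Longrightarrow> dyadic_piece f n i (a i) (l i)"
    and uniform: "forest u (uniform_leaves n) n"
  shows "forest (f \<otimes>\<^bsub>thompson_group\<^esub> u) (map (\<lambda>i. (a i, l i)) [0..<2 ^ n - 1]) (l (2 ^ n - 1))"
proof -
  define N where "N = (2::nat) ^ n - 1"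
  have "N < 2 ^ n" by (simp add: N_def)
  have N: "real N = 2 ^ n - 1" by (simp add: N_def of_nat_diff)
  have fu: "(f \<otimes>\<^bsub>thompson_group\<^esub> u) t = f (u t)" if "t \<in> {0..1}" for t
    using that by (rule thompson_group_mult[OF f u])
  have fp: "f y = (of_int (a i) + (2 ^ n * y - real i)) / 2 ^ l i"
    if "i < 2 ^ n" "real i / 2 ^ n \<le> y" "y \<le> (real i + 1) / 2 ^ n" for i y
    using piece that by (simp add: dyadic_piece_def)
  have "leaf (f \<otimes>\<^bsub>thompson_group\<^esub> u) i (a i, l i)" if i: "i < N" for i
    unfolding leaf_def
  proof
    fix t assume t: "t \<in> {spine i..spine (Suc i)}"
    have "leaf u i (int i, n)"
      using uniform i by (auto simp: forest_def uniform_leaves_def N_def)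
    then have ut: "u t = (real i + 2 ^ Suc i * (t - spine i)) / 2 ^ n"
      using leafD[of u i "int i" n t] t by simp
    have "2 ^ Suc i * (t - spine i) \<ge> 0" using t by simp
    moreover have "2 ^ Suc i * (t - spine i) \<le> 1"
      using t unfolding spine_width by (simp add: mult_nonneg_nonpos)
    ultimately have "f (u t) = (of_int (a i) + (2 ^ n * u t - real i)) / 2 ^ l i"
      using i \<open>N < 2 ^ n\<close> unfolding ut by (intro fp divide_right_mono) auto
    moreover have "t \<in> {0..1}" using t spine_nonneg[of i] spine_less_1[of "Suc i"] by simp
    ultimately show "(f \<otimes>\<^bsub>thompson_group\<^esub> u) t =
        (of_int (fst (a i, l i)) + 2 ^ Suc i * (t - spine i)) / 2 ^ snd (a i, l i)"
      by (simp add: fu ut)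
  qed
  moreover have "(f \<otimes>\<^bsub>thompson_group\<^esub> u) t = 1 - 2 ^ N * (1 - t) / 2 ^ l N"
    if t: "t \<in> {spine N..1}" for t
  proof -
    define x where "x = 2 ^ N * (1 - t)"
    have ut: "u t = 1 - x / 2 ^ n"
      using uniform t by (simp add: forest_def uniform_leaves_def N_def x_def)
    have "x \<le> 1" "0 \<le> x"
      using t by (simp_all add: x_def spine_def field_simps)
    then have fut: "f (u t) = (of_int (a N) + (2 ^ n * u t - real N)) / 2 ^ l N"
      by (intro fp) (simp_all add: ut N \<open>N < 2 ^ n\<close> field_simps)
    have "f 1 = (of_int (a N) + (2 ^ n * 1 - real N)) / 2 ^ l N"
      by (intro fp) (simp_all add: N \<open>N < 2 ^ n\<close> field_simps)
    then have "of_int (a N) = (2 ^ l N - 1 :: real)"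
      using f by (simp add: thompson_group_iff N field_simps)
    moreover have "2 ^ n * u t = 2 ^ n - x" by (simp add: ut right_diff_distrib)
    ultimately have "f (u t) = (2 ^ l N - x) / 2 ^ l N" by (simp add: fut N)
    moreover have "t \<in> {0..1}" using t spine_nonneg[of N] by simp
    ultimately show ?thesis by (simp add: fu x_def diff_divide_distrib)
  qed
  ultimately show ?thesis by (simp add: forest_def N_def)
qed

text \<open>
  For suitable \<open>n\<close> the composite of \<open>f\<close> with a uniform map \<open>u\<close> of depth \<open>n\<close> has a diagram. Refining this
  diagram turns it, up to an element \<open>h\<close> of \<open>H\<close>, into a uniform map of some depth \<open>k\<close>. Refining the
  diagram of the identity shows that all uniform maps belong to \<open>H\<close>, and then \<open>f\<close> does as well.
\<close>

theorem thompson_group_generated: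
  assumes H: "subgroup H thompson_group" and gen: "\<And>i. thompson_gen i \<in> H"
  shows "H = carrier thompson_group"
proof (intro equalityI subsetI)
  interpret H: subgroup H thompson_group by (rule H)
  show "f \<in> carrier thompson_group" if "f \<in> H" for f using that by simp
  have uniform: "\<exists>u\<in>H. forest u (uniform_leaves n) n" for n
    using forest_refine[OF H gen F.one_closed forest_one, of n] by auto
  fix f assume f: "f \<in> carrier thompson_group"
  obtain n a l where al: "\<And>i. i < 2 ^ n \<Longrightarrow> dyadic_piece f n i (a i) (l i)"
    using thompson_group_dyadic_pieces[OF f] by metis
  obtain u where u: "u \<in> H" "forest u (uniform_leaves n) n" using uniform by blast
  define k where "k = Max (l ` {..<2 ^ n})"
  have k: "l i \<le> k" if "i < 2 ^ n" for i using that by (simp add: k_def)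
  have "f \<otimes>\<^bsub>thompson_group\<^esub> u \<in> carrier thompson_group" using f u(1) by simp
  moreover have "forest (f \<otimes>\<^bsub>thompson_group\<^esub> u) (map (\<lambda>i. (a i, l i)) [0..<2 ^ n - 1]) (l (2 ^ n - 1))"
    using f u al by (intro forest_compose_uniform) auto
  ultimately have "\<exists>h\<in>H. forest (f \<otimes>\<^bsub>thompson_group\<^esub> u \<otimes>\<^bsub>thompson_group\<^esub> h) (uniform_leaves k) k"
    by (rule forest_refine[OF H gen]) (auto intro!: k)
  then obtain h where h: "h \<in> H"
    "forest (f \<otimes>\<^bsub>thompson_group\<^esub> u \<otimes>\<^bsub>thompson_group\<^esub> h) (uniform_leaves k) k" by blast
  obtain v where v: "v \<in> H" "forest v (uniform_leaves k) k" using uniform by blast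
  \<comment> \<open>maps with the same diagram are equal\<close>
  have fuh: "f \<otimes>\<^bsub>thompson_group\<^esub> u \<otimes>\<^bsub>thompson_group\<^esub> h = v"
    using f u h v by (intro thompson_group_eqI forest_determines[of _ "uniform_leaves k" k]) auto
  have "v \<otimes>\<^bsub>thompson_group\<^esub> inv\<^bsub>thompson_group\<^esub> h \<otimes>\<^bsub>thompson_group\<^esub> inv\<^bsub>thompson_group\<^esub> u = f"
    using f u(1) h(1) by (simp add: F.m_assoc F.mult_inv_cancel flip: fuh)
  moreover have "v \<otimes>\<^bsub>thompson_group\<^esub> inv\<^bsub>thompson_group\<^esub> h \<otimes>\<^bsub>thompson_group\<^esub> inv\<^bsub>thompson_group\<^esub> u \<in> H"
    using u(1) h(1) v(1) by simp
  ultimately show "f \<in> H" by simp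
qed

section \<open>The isomorphism\<close>

theorem proposition6p1:
  shows "Gr thompson_quandle \<cong> thompson_group"
proof -
  define R where "R = {(QOp (QGen j) (QGen k), QGen (k + 1)) | j k :: nat. j < k}"
  have P: "thompson_quandle = presented_quandle R"
    by (simp only: thompson_quandle_def R_def)
  let ?G = "Gr (presented_quandle R)"
  interpret G: group ?G by (rule group_Gr)
  have closed: "Gr_presented_gen R k \<in> carrier ?G" for k
    by (simp add: Gr_gen_closed presented_quandle_class)
  obtain h where h: "h \<in> hom ?G thompson_group" "\<And>k. h (Gr_presented_gen R k) = thompson_gen k"
  proof (rule Gr_presented_quandle_hom[OF group_thompson_group, of thompson_gen R])
    show "range thompson_gen \<subseteq> carrier thompson_group" using thompson_gen_closed by blast
    fix s t assume "(s, t) \<in> R"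
    then obtain j k where jk: "j < k" "s = QOp (QGen j) (QGen k)" "t = QGen (Suc k)"
      by (auto simp: R_def)
    then show "qterm_eval thompson_group thompson_gen s = qterm_eval thompson_group thompson_gen t"
      by (simp add: thompson_gen_relation F.m_assoc thompson_gen_closed)
  qed (use that in blast)
  interpret h: thompson_relations_hom ?G "Gr_presented_gen R" thompson_group thompson_gen h
  proof unfold_locales
    show "Gr_presented_gen R k \<in> carrier ?G" for k by (rule closed)
    show "Gr_presented_gen R j \<otimes>\<^bsub>?G\<^esub> Gr_presented_gen R k = Gr_presented_gen R (Suc k) \<otimes>\<^bsub>?G\<^esub> Gr_presented_gen R j" if "j < k" for j k
    proof -
      have "qcong R (QGen (Suc k)) (QOp (QGen j) (QGen k))"
        using that by (intro qcong_sym[OF qcong_relation]) (auto simp: R_def)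
      then have "qrel R `` {QGen (Suc k)} = qrel R `` {QOp (QGen j) (QGen k)}"
        by (simp only: qrel_class_eq)
      then have "Gr_presented_gen R (Suc k) = Gr_presented_gen R j \<otimes>\<^bsub>?G\<^esub> Gr_presented_gen R k \<otimes>\<^bsub>?G\<^esub> inv\<^bsub>?G\<^esub> (Gr_presented_gen R j)"
        by (simp only: Gr_presented_quandle_op)
      then show ?thesis by (simp add: closed G.m_assoc)
    qed
  qed (use h Gr_presented_quandle_generated pos_word_separated in auto)
  interpret hom: group_hom ?G thompson_group h by unfold_locales (rule h(1))
  have "h ` carrier ?G = carrier thompson_group"
  proof (rule thompson_group_generated)
    show "subgroup (h ` carrier ?G) thompson_group" by (rule hom.img_is_subgroup)
    show "thompson_gen k \<in> h ` carrier ?G" for k using h(2) closed by (metis imageI)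
  qed
  then have "h \<in> iso ?G thompson_group"
    using h(1) h.inj by (simp add: iso_def bij_betw_def)
  then show ?thesis unfolding P by (rule is_isoI)
qed

end
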